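(* Let $p\in(1,+\infty)$ and let $\mathcal{W}:\mathcal{P}_p(\mathbb{R}^d)\to\mathbb{R}\cup\{+\infty\}$ be a map with compact sublevels that is continuous over its domain $\mathrm{dom}(\mathcal{W})\subset\mathcal{P}_p(\mathbb{R}^d)$. Let $$\mathcal{Q}_{\mathcal{W}}:=\Big\{\boldsymbol{\mu}\in\mathcal{P}_p(\mathbb{R}^{d+1}):\ \boldsymbol{\mu}=\mu\times\delta_\alpha\ \text{with } \mu\in\mathcal{P}_p(\mathbb{R}^d),\ \alpha\in\mathbb{R}\ \text{and } \mathcal{W}(\mu)\le\alpha\Big\}.$$ Then for every $\boldsymbol{\mu}=\mu\times\delta_\alpha\in\mathcal{Q}_{\mathcal{W}}$ and each $(\xi,\rho)\in\mathcal{L}^p(\mathbb{R}^d,\mathbb{R}^d;\mu)\times\mathbb{R}$, it holds that $(\xi,\rho)\in T_{\mathcal{Q}_{\mathcal{W}}}(\boldsymbol{\mu})$ if and only if $$\begin{cases}\xi\in T_{\mathrm{dom}(\mathcal{W})}(\mu)\ \text{ and }\ \mathrm{D}_\uparrow\mathcal{W}(\mu)(\xi)\le\rho & \text{when } \alpha=\mathcal{W}(\mu),\\ \xi\in T_{\mathrm{dom}(\mathcal{W})}(\mu) & \text{when } \alpha>\mathcal{W}(\mu).\end{cases}$$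
   Context: For $n\ge1$, $\mathcal{P}_p(\mathbb{R}^n)$ is the set of Borel probability measures on $\mathbb{R}^n$ with finite $p$-th moment, endowed with the Wasserstein distance $W_p$ of order $p$; $f_\sharp\mu$ is the image measure. $\mathcal{L}^p(\mathbb{R}^n,\mathbb{R}^n;\mu)$ is the seminormed space of Borel maps $\mathbb{R}^n\to\mathbb{R}^n$ that are $p$-integrable with respect to $\mu$. $\mathrm{dom}(\mathcal{W})=\{\mu:\mathcal{W}(\mu)<+\infty\}$; compact sublevels means that $\{\mu:\mathcal{W}(\mu)\le c\}$ is compact in $(\mathcal{P}_p(\mathbb{R}^d),W_p)$ for every $c\in\mathbb{R}$. Contingent cone: for $\mathcal{Q}\subset\mathcal{P}_p(\mathbb{R}^n)$ and $\mu\in\mathcal{Q}$, $T_{\mathcal{Q}}(\mu)=\{\xi\in\mathcal{L}^p(\mathbb{R}^n,\mathbb{R}^n;\mu):\liminf_{h\to0^+}\frac1h\inf_{\sigma\in\mathcal{Q}}W_p((\mathrm{Id}+h\xi)_\sharp\mu,\sigma)=0\}$; it is used with $n=d$ for $\mathcal{Q}=\mathrm{dom}(\mathcal{W})$ and with $n=d+1$ for $\mathcal{Q}=\mathcal{Q}_{\mathcal{W}}$. In the latter case, the pair $(\xi,\rho)$ is identified with the map $(x,a)\in\mathbb{R}^{d}\times\mathbb{R}\mapsto(\xi(x),\rho)\in\mathbb{R}^{d+1}$. Lower directional derivative: for $\mu\in\mathrm{dom}(\mathcal{W})$ and $\xi\in T_{\mathrm{dom}(\mathcal{W})}(\mu)$,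 $$\mathrm{D}_\uparrow\mathcal{W}(\mu)(\xi):=\liminf_{\substack{h\to0^+,\ \mu_h\in\mathrm{dom}(\mathcal{W})\\ W_p((\mathrm{Id}+h\xi)_\sharp\mu,\mu_h)=o(h)}}\frac{\mathcal{W}(\mu_h)-\mathcal{W}(\mu)}{h},$$ i.e. the infimum of $\liminf_{i\to+\infty}(\mathcal{W}(\mu_{h_i})-\mathcal{W}(\mu))/h_i$ over all sequences $h_i\to0^+$ and $(\mu_{h_i})\subset\mathrm{dom}(\mathcal{W})$ with $W_p((\mathrm{Id}+h_i\xi)_\sharp\mu,\mu_{h_i})=o(h_i)$. *)

theory Defs
  imports "HOL-Probability.Probability" "HOL-Library.Landau_Symbols"
begin

definition wasserstein_space :: "real \<Rightarrow> 'a::euclidean_space measure set" where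
  "wasserstein_space p =
     {\<mu>. prob_space \<mu> \<and> sets \<mu> = sets borel \<and> integrable \<mu> (\<lambda>x. norm x powr p)}"

definition couplings ::
    "'a::euclidean_space measure \<Rightarrow> 'a measure \<Rightarrow> ('a \<times> 'a) measure set" where
  "couplings \<mu> \<nu> =
     {\<pi>. prob_space \<pi> \<and> sets \<pi> = sets borel \<and> distr \<pi> borel fst = \<mu> \<and> distr \<pi> borel snd = \<nu>}"

(* Only meaningful for measures in wasserstein_space p: there the cost is integrable against
   every coupling, and the product measure shows that the infimum is over a nonempty set. *)
definition wasserstein :: "real \<Rightarrow> 'a::euclidean_space measure \<Rightarrow> 'a measure \<Rightarrow> real" where
  "wasserstein p \<mu> \<nu> =
     (INF \<pi>\<in>couplings \<mu> \<nu>. \<integral>z. dist (fst z) (snd z) powr p \<partial>\<pi>) powr (1 / p)"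

definition wasserstein_topology :: "real \<Rightarrow> 'a::euclidean_space measure topology" where
  "wasserstein_topology p = Metric_space.mtopology (wasserstein_space p) (wasserstein p)"

definition Lp_maps :: "real \<Rightarrow> 'a::euclidean_space measure \<Rightarrow> ('a \<Rightarrow> 'a) set" where
  "Lp_maps p \<mu> = {\<xi>. \<xi> \<in> borel_measurable borel \<and> integrable \<mu> (\<lambda>x. norm (\<xi> x) powr p)}"

definition push :: "'a::euclidean_space measure \<Rightarrow> ('a \<Rightarrow> 'a) \<Rightarrow> real \<Rightarrow> 'a measure" where
  "push \<mu> \<xi> h = distr \<mu> borel (\<lambda>x. x + h *\<^sub>R \<xi> x)"

definition contingent_cone ::
    "real \<Rightarrow> 'a::euclidean_space measure set \<Rightarrow> 'a measure \<Rightarrow> ('a \<Rightarrow> 'a) set" where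
  "contingent_cone p Q \<mu> =
     {\<xi> \<in> Lp_maps p \<mu>.
        Liminf (at_right 0) (\<lambda>h. ereal (1 / h * (INF \<sigma>\<in>Q. wasserstein p (push \<mu> \<xi> h) \<sigma>))) = 0}"

(* A functional on the Wasserstein space is a total function on measures; its values outside
   wasserstein_space p are never used. *)
definition effective_domain ::
    "real \<Rightarrow> ('a::euclidean_space measure \<Rightarrow> ereal) \<Rightarrow> 'a measure set" where
  "effective_domain p W = {\<mu> \<in> wasserstein_space p. W \<mu> < \<infinity>}"

definition compact_sublevels :: "real \<Rightarrow> ('a::euclidean_space measure \<Rightarrow> ereal) \<Rightarrow> bool" where
  "compact_sublevels p W \<longleftrightarrow>
     (\<forall>c::real. compactin (wasserstein_topology p) {\<mu> \<in> wasserstein_space p. W \<mu> \<le> ereal c})"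

definition continuous_over_domain ::
    "real \<Rightarrow> ('a::euclidean_space measure \<Rightarrow> ereal) \<Rightarrow> bool" where
  "continuous_over_domain p W \<longleftrightarrow>
     continuous_map (subtopology (wasserstein_topology p) (effective_domain p W)) euclidean W"

definition lower_dir_deriv ::
    "real \<Rightarrow> ('a::euclidean_space measure \<Rightarrow> ereal) \<Rightarrow> 'a measure \<Rightarrow> ('a \<Rightarrow> 'a) \<Rightarrow> ereal" where
  "lower_dir_deriv p W \<mu> \<xi> =
     Inf {liminf (\<lambda>i. (W (m i) - W \<mu>) / ereal (h i)) | (h :: nat \<Rightarrow> real) m.
            (\<forall>i. 0 < h i) \<and> h \<longlonglongrightarrow> 0 \<and> (\<forall>i. m i \<in> effective_domain p W) \<and>
            (\<lambda>i. wasserstein p (push \<mu> \<xi> (h i)) (m i)) \<in> o(h)}"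

(* R^(d+1) is the product type 'a * real, whose norm is the Euclidean one. *)
definition epigraph_set ::
    "real \<Rightarrow> ('a::euclidean_space measure \<Rightarrow> ereal) \<Rightarrow> ('a \<times> real) measure set" where
  "epigraph_set p W =
     {M \<in> wasserstein_space p. \<exists>\<mu> \<alpha>. M = \<mu> \<Otimes>\<^sub>M return borel \<alpha> \<and>
        \<mu> \<in> wasserstein_space p \<and> W \<mu> \<le> ereal \<alpha>}"

end

theory Submission imports Defs begin

text \<open>
  The cone of the epigraph, the cone of the domain and the lower directional derivative are all
  compared with one property, \<open>slope_attainable p W \<mu> \<alpha> \<xi> \<rho>\<close>: for each \<open>e > 0\<close> there are arbitrarily
  small \<open>h > 0\<close> and measures \<open>\<nu>\<close> in the domain of \<open>W\<close> with \<open>\<nu>\<close> within \<open>e * h\<close> of \<open>push \<mu> \<xi> h\<close> and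
  \<open>W \<nu> < \<alpha> + h * (\<rho> + e)\<close>.

  The Wasserstein distance between two measures at constant heights dominates the distance of their
  bases and the difference of their heights, and is at most the sum of both. Hence
  \<open>(\<xi>, \<rho>)\<close> is tangent to the epigraph at \<open>(\<mu>, \<alpha>)\<close> iff the slope \<open>\<rho>\<close> is attainable
  (\<open>contingent_cone_epigraph_iff\<close>). Attainability always puts \<open>\<xi>\<close> in the cone of the domain. On the
  graph, where \<open>\<alpha> = W \<mu>\<close>, it says that difference quotients come arbitrarily close to \<open>\<rho>\<close> or below,
  that is, that the lower directional derivative is at most \<open>\<rho>\<close> (\<open>lower_dir_deriv_le_iff\<close>). Strictly
  above the graph the bound on \<open>W \<nu>\<close> holds automatically for small \<open>h\<close> by continuity of \<open>W\<close> on its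
  domain, so that attainability reduces to tangency of \<open>\<xi>\<close> to the domain
  (\<open>contingent_imp_slope_attainable\<close>).

  This last step uses that the Wasserstein distance is a metric (\<open>Metric_space_wasserstein\<close>): the
  approximating measures must converge to \<open>\<mu>\<close>, which is the triangle inequality, and the topology in
  which \<open>W\<close> is continuous is the metric one. The triangle inequality combines Minkowski's inequality
  with a gluing of couplings along a countable partition into small cells (\<open>gluing_up_to\<close>).
\<close>

section \<open>Minkowski inequality for \<open>p\<close>-th powers\<close>
lemma convex_on_powr_nonneg:
  fixes p :: real
  assumes p: "1 \<le> p"
  shows "convex_on {0..} (\<lambda>x. x powr p)"
proof (rule convex_on_linorderI)
  fix t x y :: real
  assume t: "0 < t" "t < 1" and xy: "x \<in> {0..}" "y \<in> {0..}" "x < y"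
  show "((1 - t) *\<^sub>R x + t *\<^sub>R y) powr p \<le> (1 - t) * x powr p + t * y powr p"
  proof (cases "x = 0")
    case True
    have "(t * y) powr p = t powr p * y powr p"
      using t xy by (simp add: powr_mult)
    also have "\<dots> \<le> t powr 1 * y powr p"
      using t p by (intro mult_right_mono powr_mono') auto
    finally show ?thesis
      using True t by simp
  next
    case False
    then show ?thesis
      using convex_onD[OF powr_convex[OF p], of t x y] t xy by simp
  qed
qed simp

text \<open>
  Convexity of \<open>x powr p\<close>, applied to \<open>s + t\<close> written as \<open>a + b\<close> times the average of \<open>s / a\<close> and
  \<open>t / b\<close> with weights \<open>a / (a + b)\<close> and \<open>b / (a + b)\<close>. For these weights the right-hand side
  integrates to at most \<open>(a + b) powr p\<close> as soon as \<open>a\<close> and \<open>b\<close> bound the \<open>L\<^sup>p\<close> norms of the two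
  summands, which is Minkowski's inequality.
\<close>
lemma powr_sum_le_convex:
  fixes p a b s t :: real
  assumes p: "1 \<le> p" and ab: "0 < a" "0 < b" and st: "0 \<le> s" "0 \<le> t"
  shows "(s + t) powr p \<le> (a + b) powr p *
     (a / (a + b) * (s powr p / a powr p) + b / (a + b) * (t powr p / b powr p))"
proof -
  have sum1: "a / (a + b) + b / (a + b) = 1"
    using ab by (simp add: add_divide_distrib[symmetric])
  have eq: "s + t = (a + b) * (a / (a + b) * (s / a) + b / (a + b) * (t / b))"
  proof -
    have "a / (a + b) * (s / a) = s / (a + b)" "b / (a + b) * (t / b) = t / (a + b)"
      using ab by simp_all
    then show ?thesis
      using ab by (simp add: add_divide_distrib[symmetric])
  qed
  have cx: "(a / (a + b) * (s / a) + b / (a + b) * (t / b)) powr p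
      \<le> a / (a + b) * (s / a) powr p + b / (a + b) * (t / b) powr p"
    using convex_onD[OF convex_on_powr_nonneg[OF p], of "b / (a + b)" "s / a" "t / b"] ab st sum1
    by (simp add: eq_diff_eq[symmetric] zero_le_divide_iff)
  have "(s + t) powr p = (a + b) powr p * (a / (a + b) * (s / a) + b / (a + b) * (t / b)) powr p"
    using ab st by (subst eq, subst powr_mult) auto
  also have "\<dots> \<le> (a + b) powr p * (a / (a + b) * (s / a) powr p + b / (a + b) * (t / b) powr p)"
    by (intro mult_left_mono cx) auto
  finally show ?thesis
    using ab st by (simp add: powr_divide)
qed

text \<open>
  The norms are replaced by arbitrary positive bounds \<open>a\<close> and \<open>b\<close>: this avoids \<open>p\<close>-th roots and
  the case of a vanishing norm, and it is the form in which nearly optimal couplings deliver their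
  cost.
\<close>
lemma minkowski_powr:
  fixes f g :: "'b \<Rightarrow> real"
  assumes p: "1 \<le> p"
    and meas: "f \<in> borel_measurable M" "g \<in> borel_measurable M"
    and nonneg: "\<And>x. 0 \<le> f x" "\<And>x. 0 \<le> g x"
    and int: "integrable M (\<lambda>x. f x powr p)" "integrable M (\<lambda>x. g x powr p)"
  shows integrable_powr_add: "integrable M (\<lambda>x. (f x + g x) powr p)"
    and integral_powr_add_le: "\<lbrakk>0 < a; 0 < b; (\<integral>x. f x powr p \<partial>M) \<le> a powr p;
      (\<integral>x. g x powr p \<partial>M) \<le> b powr p\<rbrakk> \<Longrightarrow> (\<integral>x. (f x + g x) powr p \<partial>M) \<le> (a + b) powr p"
proof -
  let ?u = "\<lambda>a b x. (a + b) powr p *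
     (a / (a + b) * (f x powr p / a powr p) + b / (a + b) * (g x powr p / b powr p))"
  have u_int: "integrable M (?u a b)" for a b :: real
    using int by simp
  show add_int: "integrable M (\<lambda>x. (f x + g x) powr p)"
  proof (rule Bochner_Integration.integrable_bound[OF u_int[of 1 1]])
    show "AE x in M. norm ((f x + g x) powr p) \<le> norm (?u 1 1 x)"
      using powr_sum_le_convex[OF p, of 1 1] nonneg by (intro AE_I2) fastforce
  qed (use meas in measurable)
  assume ab: "0 < a" "0 < b"
    and le: "(\<integral>x. f x powr p \<partial>M) \<le> a powr p" "(\<integral>x. g x powr p \<partial>M) \<le> b powr p"
  have "(\<integral>x. (f x + g x) powr p \<partial>M) \<le> (\<integral>x. ?u a b x \<partial>M)"
    using powr_sum_le_convex[OF p ab] nonneg by (intro integral_mono add_int u_int) auto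
  also have "\<dots> = (a + b) powr p * (a / (a + b) * ((\<integral>x. f x powr p \<partial>M) / a powr p)
      + b / (a + b) * ((\<integral>x. g x powr p \<partial>M) / b powr p))"
    using int by simp
  also have "\<dots> \<le> (a + b) powr p * (a / (a + b) * 1 + b / (a + b) * 1)"
    using ab le by (intro mult_left_mono add_mono) (auto simp: divide_le_eq_1)
  also have "a / (a + b) * 1 + b / (a + b) * 1 = 1"
    using ab by (simp add: add_divide_distrib[symmetric])
  finally show "(\<integral>x. (f x + g x) powr p \<partial>M) \<le> (a + b) powr p"
    by simp
qed

section \<open>Gluing\<close>
text \<open>
  Draws from \<open>P\<close> and \<open>R\<close> are made conditionally independent given the common value of \<open>f\<close> and \<open>g\<close>.
  Because this value is discrete, the conditioning is elementary: on the event \<open>f = g = i\<close>, the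
  product measure is reweighted by the inverse of the common probability \<open>m i\<close> of the value \<open>i\<close>.
\<close>
lemma discrete_gluing:
  fixes f :: "'b \<Rightarrow> nat" and g :: "'c \<Rightarrow> nat"
  assumes "prob_space P" "prob_space R"
    and f[measurable]: "f \<in> measurable P (count_space UNIV)"
    and g[measurable]: "g \<in> measurable R (count_space UNIV)"
    and eq: "distr P (count_space UNIV) f = distr R (count_space UNIV) g"
  obtains G where "prob_space G" "sets G = sets (P \<Otimes>\<^sub>M R)"
    "distr G P fst = P" "distr G R snd = R" "AE w in G. f (fst w) = g (snd w)"
proof -
  interpret P: prob_space P by fact
  interpret R: prob_space R by fact
  interpret PR: pair_sigma_finite P R ..
  define m where "m i = emeasure P {u \<in> space P. f u = i}" for i
  have m_R: "m i = emeasure R {v \<in> space R. g v = i}" for i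
  proof -
    have "emeasure (distr P (count_space UNIV) f) {i} = emeasure (distr R (count_space UNIV) g) {i}"
      by (simp add: eq)
    then show ?thesis
      by (simp add: emeasure_distr m_def vimage_def Int_def conj_commute)
  qed
  have m_fin: "m i \<noteq> \<infinity>" for i
    by (simp add: m_def)
  \<comment> \<open>The weight below has total mass \<open>1\<close> on each fibre where \<open>m\<close> does not vanish; the other fibres form a countable union of
    null level sets.\<close>
  have P_pos: "AE u in P. m (f u) \<noteq> 0"
  proof -
    have "AE u in P. f u = i \<longrightarrow> m i \<noteq> 0" for i
      by (cases "m i = 0") (auto simp: m_def intro!: AE_I[where N="{u \<in> space P. f u = i}"])
    then have "AE u in P. \<forall>i. f u = i \<longrightarrow> m i \<noteq> 0"
      by (intro iffD2[OF AE_all_countable] allI)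
    then show ?thesis by simp
  qed
  have R_pos: "AE v in R. m (g v) \<noteq> 0"
  proof -
    have "AE v in R. g v = i \<longrightarrow> m i \<noteq> 0" for i
      by (cases "m i = 0") (auto simp: m_R intro!: AE_I[where N="{v \<in> space R. g v = i}"])
    then have "AE v in R. \<forall>i. g v = i \<longrightarrow> m i \<noteq> 0"
      by (intro iffD2[OF AE_all_countable] allI)
    then show ?thesis by simp
  qed
  define w where "w z = (if f (fst z) = g (snd z) then inverse (m (f (fst z))) else 0)" for z
  have [measurable]: "Measurable.pred (P \<Otimes>\<^sub>M R) (\<lambda>z. f (fst z) = g (snd z))"
  proof -
    have "Measurable.pred (P \<Otimes>\<^sub>M R) (\<lambda>z. \<exists>i. f (fst z) = i \<and> g (snd z) = i)"
      by measurable
    then show ?thesis by (simp cong: conj_cong add: eq_commute)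
  qed
  have [measurable]: "(\<lambda>z. m (f (fst z))) \<in> borel_measurable (P \<Otimes>\<^sub>M R)"
    by (rule measurable_compose[of "\<lambda>z. f (fst z)" _ "count_space UNIV"]) auto
  have w[measurable]: "w \<in> borel_measurable (P \<Otimes>\<^sub>M R)"
    unfolding w_def by measurable
  define G where "G = density (P \<Otimes>\<^sub>M R) w"
  have sets_G[measurable_cong]: "sets G = sets (P \<Otimes>\<^sub>M R)"
    by (simp add: G_def)
  have inner_R: "AE u in P. (\<integral>\<^sup>+v. w (u, v) \<partial>R) = 1"
    using P_pos
  proof eventually_elim
    case (elim u)
    have "(\<integral>\<^sup>+v. w (u, v) \<partial>R) = (\<integral>\<^sup>+v. inverse (m (f u)) * indicator {v \<in> space R. g v = f u} v \<partial>R)"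
      by (intro nn_integral_cong) (auto simp: w_def split: split_indicator)
    also have "\<dots> = inverse (m (f u)) * m (f u)"
      by (simp add: nn_integral_cmult_indicator m_R)
    also have "\<dots> = 1"
      using elim m_fin[of "f u"] by (subst mult.commute, intro ennreal_divide_self[unfolded divide_ennreal_def]) (auto simp: top.not_eq_extremum)
    finally show ?case .
  qed
  have inner_P: "AE v in R. (\<integral>\<^sup>+u. w (u, v) \<partial>P) = 1"
    using R_pos
  proof eventually_elim
    case (elim v)
    have "(\<integral>\<^sup>+u. w (u, v) \<partial>P) = (\<integral>\<^sup>+u. inverse (m (g v)) * indicator {u \<in> space P. f u = g v} u \<partial>P)"
      by (intro nn_integral_cong) (auto simp: w_def split: split_indicator)
    also have "\<dots> = inverse (m (g v)) * m (g v)"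
      by (simp add: nn_integral_cmult_indicator m_def)
    also have "\<dots> = 1"
      using elim m_fin[of "g v"] by (subst mult.commute, intro ennreal_divide_self[unfolded divide_ennreal_def]) (auto simp: top.not_eq_extremum)
    finally show ?case .
  qed
  have marg1: "distr G P fst = P"
  proof (rule measure_eqI)
    fix A assume "A \<in> sets (distr G P fst)"
    then have A[measurable]: "A \<in> sets P" by simp
    have "emeasure (distr G P fst) A = emeasure G (fst -` A \<inter> space (P \<Otimes>\<^sub>M R))"
      by (subst emeasure_distr) (auto simp: G_def)
    also have "\<dots> = (\<integral>\<^sup>+z. w z * indicator (fst -` A \<inter> space (P \<Otimes>\<^sub>M R)) z \<partial>(P \<Otimes>\<^sub>M R))"
      unfolding G_def by (rule emeasure_density) measurable
    also have "\<dots> = (\<integral>\<^sup>+z. w z * indicator A (fst z) \<partial>(P \<Otimes>\<^sub>M R))"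
      by (intro nn_integral_cong) (auto split: split_indicator)
    also have "\<dots> = (\<integral>\<^sup>+u. \<integral>\<^sup>+v. w (u, v) * indicator A u \<partial>R \<partial>P)"
      by (subst R.nn_integral_fst[symmetric]) auto
    also have "\<dots> = (\<integral>\<^sup>+u. indicator A u \<partial>P)"
      by (rule nn_integral_cong_AE, use inner_R in eventually_elim)
        (simp split: split_indicator)
    finally show "emeasure (distr G P fst) A = emeasure P A" by simp
  qed simp
  have marg2: "distr G R snd = R"
  proof (rule measure_eqI)
    fix A assume "A \<in> sets (distr G R snd)"
    then have A[measurable]: "A \<in> sets R" by simp
    have "emeasure (distr G R snd) A = emeasure G (snd -` A \<inter> space (P \<Otimes>\<^sub>M R))"
      by (subst emeasure_distr) (auto simp: G_def)
    also have "\<dots> = (\<integral>\<^sup>+z. w z * indicator (snd -` A \<inter> space (P \<Otimes>\<^sub>M R)) z \<partial>(P \<Otimes>\<^sub>M R))"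
      unfolding G_def by (rule emeasure_density) measurable
    also have "\<dots> = (\<integral>\<^sup>+z. w z * indicator A (snd z) \<partial>(P \<Otimes>\<^sub>M R))"
      by (intro nn_integral_cong) (auto split: split_indicator)
    also have "\<dots> = (\<integral>\<^sup>+v. \<integral>\<^sup>+u. w (u, v) * indicator A v \<partial>P \<partial>R)"
      by (subst PR.nn_integral_snd[symmetric]) auto
    also have "\<dots> = (\<integral>\<^sup>+v. indicator A v \<partial>R)"
      by (rule nn_integral_cong_AE, use inner_P in eventually_elim)
        (simp split: split_indicator)
    finally show "emeasure (distr G R snd) A = emeasure R A" by simp
  qed simp
  have "prob_space (distr G P fst)"
    unfolding marg1 by fact
  then have "prob_space G"
    by (rule prob_space_distrD[rotated]) measurable
  moreover have "AE z in G. f (fst z) = g (snd z)"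
    unfolding G_def by (subst AE_density[OF w]) (auto simp: w_def)
  ultimately show thesis
    using that sets_G marg1 marg2 by blast
qed

text \<open>
  Cells of diameter at most \<open>e\<close>: each point is sent to the index of the first point of a countable
  dense set that is closer than \<open>e / 2\<close>.
\<close>
lemma countable_small_cells:
  fixes e :: real
  assumes "0 < e"
  obtains k :: "'a::euclidean_space \<Rightarrow> nat"
  where "k \<in> measurable borel (count_space UNIV)" "\<And>x y. k x = k y \<Longrightarrow> dist x y \<le> e"
proof -
  obtain D :: "'a set" where D: "countable D" "\<And>X. open X \<Longrightarrow> X \<noteq> {} \<Longrightarrow> \<exists>d\<in>D. d \<in> X"
    using countable_dense_setE by blast
  have near: "\<exists>n. dist x (from_nat_into D n) < e / 2" for x
  proof -
    obtain d where "d \<in> D" "d \<in> ball x (e / 2)"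
      using D(2)[of "ball x (e / 2)"] assms by auto
    then show ?thesis
      using from_nat_into_surj[OF D(1)] by (metis mem_ball)
  qed
  define k where "k x = (LEAST n. dist x (from_nat_into D n) < e / 2)" for x :: 'a
  have k: "dist x (from_nat_into D (k x)) < e / 2" for x
    unfolding k_def using near[of x] by (rule LeastI_ex)
  have "k \<in> measurable borel (count_space UNIV)"
    unfolding k_def by measurable
  moreover have "dist x y \<le> e" if "k x = k y" for x y
    using k[of x] k[of y] that dist_triangle2[of x y "from_nat_into D (k x)"] by simp
  ultimately show thesis using that by blast
qed

section \<open>Couplings and the Wasserstein distance\<close>
lemma borel_measurable_fst_comp [measurable (raw)]:
  fixes f :: "'b \<Rightarrow> 'c::second_countable_topology \<times> 'd::second_countable_topology"
  assumes "f \<in> borel_measurable M"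
  shows "(\<lambda>x. fst (f x)) \<in> borel_measurable M"
  using assms by (rule measurable_compose) (intro borel_measurable_continuous_onI continuous_intros)

lemma borel_measurable_snd_comp [measurable (raw)]:
  fixes f :: "'b \<Rightarrow> 'c::second_countable_topology \<times> 'd::second_countable_topology"
  assumes "f \<in> borel_measurable M"
  shows "(\<lambda>x. snd (f x)) \<in> borel_measurable M"
  using assms by (rule measurable_compose) (intro borel_measurable_continuous_onI continuous_intros)

lemma wasserstein_spaceD:
  assumes "\<mu> \<in> wasserstein_space p"
  shows "prob_space \<mu>" "sets \<mu> = sets borel" "integrable \<mu> (\<lambda>x. norm x powr p)"
  using assms by (auto simp: wasserstein_space_def)

lemma couplingsD:
  assumes "\<pi> \<in> couplings \<mu> \<nu>"
  shows "prob_space \<pi>" "sets \<pi> = sets borel" "distr \<pi> borel fst = \<mu>" "distr \<pi> borel snd = \<nu>"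
  using assms by (auto simp: couplings_def)

lemma distr_in_couplings:
  assumes "prob_space M" "f \<in> borel_measurable M" "g \<in> borel_measurable M"
  shows "distr M borel (\<lambda>w. (f w, g w)) \<in> couplings (distr M borel f) (distr M borel g)"
  using assms unfolding couplings_def
  by (auto intro!: prob_space.prob_space_distr simp: distr_distr comp_def)

lemma couplings_nonempty:
  assumes "\<mu> \<in> wasserstein_space p" "\<nu> \<in> wasserstein_space p"
  shows "couplings \<mu> \<nu> \<noteq> {}"
proof -
  interpret mu: prob_space \<mu> using assms by (simp add: wasserstein_spaceD)
  interpret nu: prob_space \<nu> using assms by (simp add: wasserstein_spaceD)
  interpret P: pair_prob_space \<mu> \<nu> ..
  note [measurable_cong] = wasserstein_spaceD(2)[OF assms(1)] wasserstein_spaceD(2)[OF assms(2)]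
  have "distr (\<mu> \<Otimes>\<^sub>M \<nu>) borel (\<lambda>w. (fst w, snd w)) \<in> couplings (distr (\<mu> \<Otimes>\<^sub>M \<nu>) borel fst) (distr (\<mu> \<Otimes>\<^sub>M \<nu>) borel snd)"
    by (rule distr_in_couplings) (auto intro: P.prob_space_axioms)
  moreover have "distr (\<mu> \<Otimes>\<^sub>M \<nu>) borel fst = \<mu>"
    using nu.distr_pair_fst[of \<mu>] by (simp add: wasserstein_spaceD[OF assms(1)] cong: distr_cong)
  moreover have "distr (\<mu> \<Otimes>\<^sub>M \<nu>) borel snd = \<nu>"
  proof (rule measure_eqI)
    fix A assume "A \<in> sets (distr (\<mu> \<Otimes>\<^sub>M \<nu>) borel snd)"
    then have A[measurable]: "A \<in> sets \<nu>" "A \<in> sets borel"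
      by (simp_all add: wasserstein_spaceD[OF assms(2)])
    have "emeasure (distr (\<mu> \<Otimes>\<^sub>M \<nu>) borel snd) A = emeasure (\<mu> \<Otimes>\<^sub>M \<nu>) (space \<mu> \<times> A)"
      using sets.sets_into_space[OF A(1)] 
      by (subst emeasure_distr) (auto simp: space_pair_measure intro!: arg_cong2[where f=emeasure])
    then show "emeasure (distr (\<mu> \<Otimes>\<^sub>M \<nu>) borel snd) A = emeasure \<nu> A"
      by (simp add: nu.emeasure_pair_measure_Times mu.emeasure_space_1)
  qed (simp add: wasserstein_spaceD[OF assms(2)])
  ultimately show ?thesis by auto
qed

lemma integrable_coupling_cost:
  assumes p: "1 \<le> p" and \<pi>: "\<pi> \<in> couplings \<mu> \<nu>"
    and mn: "\<mu> \<in> wasserstein_space p" "\<nu> \<in> wasserstein_space p"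
  shows "integrable \<pi> (\<lambda>z. dist (fst z) (snd z) powr p)"
proof -
  note [measurable_cong] = couplingsD(2)[OF \<pi>]
  have "integrable (distr \<pi> borel fst) (\<lambda>x. norm x powr p)"
       "integrable (distr \<pi> borel snd) (\<lambda>x. norm x powr p)"
    using mn by (simp_all add: couplingsD[OF \<pi>] wasserstein_spaceD)
  then have "integrable \<pi> (\<lambda>z. norm (fst z) powr p)" "integrable \<pi> (\<lambda>z. norm (snd z) powr p)"
    by (simp_all add: integrable_distr_eq)
  then have "integrable \<pi> (\<lambda>z. (norm (fst z) + norm (snd z)) powr p)"
    by (intro integrable_powr_add[OF p]) auto
  then show ?thesis
  proof (rule Bochner_Integration.integrable_bound)
    show "AE z in \<pi>. norm (dist (fst z) (snd z) powr p) \<le> norm ((norm (fst z) + norm (snd z)) powr p)"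
      using p by (intro AE_I2) (auto intro!: powr_mono2 simp: dist_norm norm_triangle_ineq4)
  qed measurable
qed

lemma wasserstein_nonneg: "0 \<le> wasserstein p \<mu> \<nu>"
  by (simp add: wasserstein_def)

lemma wasserstein_le:
  assumes p: "0 < p" and \<pi>: "\<pi> \<in> couplings \<mu> \<nu>" and t: "0 \<le> t"
    and le: "(\<integral>z. dist (fst z) (snd z) powr p \<partial>\<pi>) \<le> t powr p"
  shows "wasserstein p \<mu> \<nu> \<le> t"
proof -
  let ?c = "\<lambda>\<pi>. \<integral>z. dist (fst z) (snd z) powr p \<partial>\<pi>"
  have "(INF \<pi>\<in>couplings \<mu> \<nu>. ?c \<pi>) \<le> t powr p"
    using \<pi> le by (intro cINF_lower2[where x=\<pi>]) (auto intro!: bdd_belowI[of _ 0] integral_nonneg_AE)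
  moreover have "0 \<le> (INF \<pi>\<in>couplings \<mu> \<nu>. ?c \<pi>)"
    using \<pi> by (intro cINF_greatest) (auto intro!: integral_nonneg_AE)
  ultimately have "wasserstein p \<mu> \<nu> \<le> (t powr p) powr (1 / p)"
    unfolding wasserstein_def using p by (intro powr_mono2) auto
  then show ?thesis
    using p t by (simp add: powr_powr)
qed

text \<open>
  Together with \<open>wasserstein_le\<close>, this replaces the infimum in the definition by single couplings.
\<close>
lemma wasserstein_less_obtain:
  assumes p: "0 < p" and mn: "\<mu> \<in> wasserstein_space p" "\<nu> \<in> wasserstein_space p"
    and less: "wasserstein p \<mu> \<nu> < t"
  obtains \<pi> where "\<pi> \<in> couplings \<mu> \<nu>" "(\<integral>z. dist (fst z) (snd z) powr p \<partial>\<pi>) \<le> t powr p"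
proof -
  let ?c = "\<lambda>\<pi>. \<integral>z. dist (fst z) (snd z) powr p \<partial>\<pi>"
  have ne: "couplings \<mu> \<nu> \<noteq> {}"
    using couplings_nonempty[OF mn] .
  have I0: "0 \<le> (INF \<pi>\<in>couplings \<mu> \<nu>. ?c \<pi>)"
    using ne by (intro cINF_greatest) (auto intro!: integral_nonneg_AE)
  have "(INF \<pi>\<in>couplings \<mu> \<nu>. ?c \<pi>) = wasserstein p \<mu> \<nu> powr p"
    unfolding wasserstein_def using p I0 by (simp add: powr_powr)
  also have "\<dots> < t powr p"
    using less p wasserstein_nonneg[of p \<mu> \<nu>] by (intro powr_less_mono2) auto
  finally have "\<exists>\<pi>\<in>couplings \<mu> \<nu>. ?c \<pi> < t powr p"
    using ne by (subst (asm) cINF_less_iff) (auto intro!: bdd_belowI[of _ 0] integral_nonneg_AE)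
  then show thesis
    using that by fastforce
qed

text \<open>
  The classical gluing lemma makes the two middle points coincide. Letting them only fall in the
  same small cell costs an error \<open>e\<close>, harmless for the triangle inequality, and reduces the
  construction to the discrete case.
\<close>
lemma gluing_up_to:
  fixes \<mu>1 \<mu>2 \<mu>3 :: "'a::euclidean_space measure"
  assumes \<pi>: "\<pi> \<in> couplings \<mu>1 \<mu>2" and \<rho>: "\<rho> \<in> couplings \<mu>2 \<mu>3" and e: "0 < e"
  obtains G where "prob_space G" "sets G = sets borel" "distr G borel fst = \<pi>" "distr G borel snd = \<rho>"
    "AE w in G. dist (snd (fst w)) (fst (snd w)) \<le> e"
proof -
  note [measurable_cong] = couplingsD(2)[OF \<pi>] couplingsD(2)[OF \<rho>]
  obtain k :: "'a \<Rightarrow> nat" where k[measurable]: "k \<in> measurable borel (count_space UNIV)"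
    and close: "\<And>x y. k x = k y \<Longrightarrow> dist x y \<le> e"
    using countable_small_cells[OF e] by blast
  have eq: "distr \<pi> (count_space UNIV) (\<lambda>u. k (snd u)) = distr \<rho> (count_space UNIV) (\<lambda>v. k (fst v))"
  proof -
    have "distr (distr \<pi> borel snd) (count_space UNIV) k = distr (distr \<rho> borel fst) (count_space UNIV) k"
      by (simp add: couplingsD[OF \<pi>] couplingsD[OF \<rho>])
    then show ?thesis
      by (simp add: distr_distr comp_def)
  qed
  obtain G where G: "prob_space G" "sets G = sets (\<pi> \<Otimes>\<^sub>M \<rho>)"
    "distr G \<pi> fst = \<pi>" "distr G \<rho> snd = \<rho>" "AE w in G. k (snd (fst w)) = k (fst (snd w))"
    by (rule discrete_gluing[OF couplingsD(1)[OF \<pi>] couplingsD(1)[OF \<rho>] _ _ eq]) auto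
  have "sets G = sets borel"
    using sets_pair_measure_cong[OF couplingsD(2)[OF \<pi>] couplingsD(2)[OF \<rho>]]
    by (simp add: G(2) borel_prod[symmetric])
  moreover have "distr G borel fst = \<pi>"
    using G(3) by (simp add: couplingsD(2)[OF \<pi>] cong: distr_cong)
  moreover have "distr G borel snd = \<rho>"
    using G(4) by (simp add: couplingsD(2)[OF \<rho>] cong: distr_cong)
  moreover have "AE w in G. dist (snd (fst w)) (fst (snd w)) \<le> e"
    using G(5) by eventually_elim (rule close)
  ultimately show thesis
    using that G(1) by blast
qed

text \<open>
  For the glued measure, the distance between the outer points is at most the sum of the two coupled
  distances and the gluing error; Minkowski's inequality bounds the \<open>L\<^sup>p\<close> norm of the sum.
\<close>
lemma wasserstein_triangle:
  fixes \<mu>1 \<mu>2 \<mu>3 :: "'a::euclidean_space measure"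
  assumes p: "1 \<le> p"
    and m: "\<mu>1 \<in> wasserstein_space p" "\<mu>2 \<in> wasserstein_space p" "\<mu>3 \<in> wasserstein_space p"
  shows "wasserstein p \<mu>1 \<mu>3 \<le> wasserstein p \<mu>1 \<mu>2 + wasserstein p \<mu>2 \<mu>3"
proof (rule field_le_epsilon)
  fix e' :: real assume "0 < e'"
  define e where "e = e' / 3"
  have e: "0 < e" using \<open>0 < e'\<close> by (simp add: e_def)
  define a where "a = wasserstein p \<mu>1 \<mu>2 + e"
  define b where "b = wasserstein p \<mu>2 \<mu>3 + e"
  have ab: "0 < a" "0 < b"
    using e wasserstein_nonneg[of p \<mu>1 \<mu>2] wasserstein_nonneg[of p \<mu>2 \<mu>3]
    by (auto simp: a_def b_def)
  obtain \<pi> where \<pi>: "\<pi> \<in> couplings \<mu>1 \<mu>2" "(\<integral>z. dist (fst z) (snd z) powr p \<partial>\<pi>) \<le> a powr p"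
    using wasserstein_less_obtain[of p \<mu>1 \<mu>2 a] p m e by (auto simp: a_def)
  obtain \<rho> where \<rho>: "\<rho> \<in> couplings \<mu>2 \<mu>3" "(\<integral>z. dist (fst z) (snd z) powr p \<partial>\<rho>) \<le> b powr p"
    using wasserstein_less_obtain[of p \<mu>2 \<mu>3 b] p m e by (auto simp: b_def)
  obtain G where "prob_space G" and sG: "sets G = sets borel"
    and G1: "distr G borel fst = \<pi>" and G2: "distr G borel snd = \<rho>"
    and G3: "AE w in G. dist (snd (fst w)) (fst (snd w)) \<le> e"
    using gluing_up_to[OF \<pi>(1) \<rho>(1) e] by blast
  interpret G: prob_space G by fact
  note [measurable_cong] = sG
  let ?\<gamma> = "distr G borel (\<lambda>w. (fst (fst w), snd (snd w)))"
  let ?f = "\<lambda>w::('a \<times> 'a) \<times> ('a \<times> 'a). dist (fst (fst w)) (snd (fst w))"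
  let ?g = "\<lambda>w::('a \<times> 'a) \<times> ('a \<times> 'a). dist (fst (snd w)) (snd (snd w))"
  have \<gamma>: "?\<gamma> \<in> couplings \<mu>1 \<mu>3"
  proof -
    have "distr G borel (\<lambda>w. fst (fst w)) = distr (distr G borel fst) borel fst"
         "distr G borel (\<lambda>w. snd (snd w)) = distr (distr G borel snd) borel snd"
      by (simp_all add: distr_distr comp_def)
    then have "distr G borel (\<lambda>w. fst (fst w)) = \<mu>1" "distr G borel (\<lambda>w. snd (snd w)) = \<mu>3"
      by (simp_all add: G1 G2 couplingsD[OF \<pi>(1)] couplingsD[OF \<rho>(1)])
    then show ?thesis
      using distr_in_couplings[OF \<open>prob_space G\<close>, of "\<lambda>w. fst (fst w)" "\<lambda>w. snd (snd w)"] by simp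
  qed
  have f: "integrable G (\<lambda>w. ?f w powr p)" "(\<integral>w. ?f w powr p \<partial>G) \<le> a powr p"
    using integrable_coupling_cost[OF p \<pi>(1) m(1,2)] \<pi>(2)
    unfolding G1[symmetric] by (simp_all add: integrable_distr_eq integral_distr)
  have g: "integrable G (\<lambda>w. ?g w powr p)" "(\<integral>w. ?g w powr p \<partial>G) \<le> b powr p"
    using integrable_coupling_cost[OF p \<rho>(1) m(2,3)] \<rho>(2)
    unfolding G2[symmetric] by (simp_all add: integrable_distr_eq integral_distr)
  have fg: "integrable G (\<lambda>w. (?f w + ?g w) powr p)" "(\<integral>w. (?f w + ?g w) powr p \<partial>G) \<le> (a + b) powr p"
    using p f g ab by (auto intro!: integrable_powr_add integral_powr_add_le)
  have fge: "integrable G (\<lambda>w. (?f w + ?g w + e) powr p)"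
    "(\<integral>w. (?f w + ?g w + e) powr p \<partial>G) \<le> (a + b + e) powr p"
    using p fg ab e by (auto intro!: integrable_powr_add integral_powr_add_le simp: G.prob_space)
  have "(\<integral>z. dist (fst z) (snd z) powr p \<partial>?\<gamma>) = (\<integral>w. dist (fst (fst w)) (snd (snd w)) powr p \<partial>G)"
    by (subst integral_distr) auto
  also have "\<dots> \<le> (\<integral>w. (?f w + ?g w + e) powr p \<partial>G)"
  proof (rule integral_mono_AE[OF _ fge(1)])
    show "AE w in G. dist (fst (fst w)) (snd (snd w)) powr p \<le> (?f w + ?g w + e) powr p"
      using G3
    proof eventually_elim
      case (elim w)
      have "dist (fst (fst w)) (snd (snd w)) \<le> ?f w + ?g w + e"
        using elim dist_triangle[of "fst (fst w)" "snd (snd w)" "snd (fst w)"]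
          dist_triangle[of "snd (fst w)" "snd (snd w)" "fst (snd w)"] by linarith
      then show ?case using p by (intro powr_mono2) auto
    qed
    have "integrable ?\<gamma> (\<lambda>z. dist (fst z) (snd z) powr p)"
      by (rule integrable_coupling_cost[OF p \<gamma> m(1,3)])
    then show "integrable G (\<lambda>w. dist (fst (fst w)) (snd (snd w)) powr p)"
      by (simp add: integrable_distr_eq)
  qed
  also note fge(2)
  finally have "wasserstein p \<mu>1 \<mu>3 \<le> a + b + e"
    using p ab e by (intro wasserstein_le[OF _ \<gamma>]) auto
  then show "wasserstein p \<mu>1 \<mu>3 \<le> wasserstein p \<mu>1 \<mu>2 + wasserstein p \<mu>2 \<mu>3 + e'"
    by (simp add: a_def b_def e_def)
qed

lemma wasserstein_commute: "wasserstein p \<mu> \<nu> = wasserstein p \<nu> \<mu>"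
proof -
  let ?s = "\<lambda>\<pi>::('a \<times> 'a) measure. distr \<pi> borel (\<lambda>z. (snd z, fst z))"
  let ?c = "\<lambda>\<pi>::('a \<times> 'a) measure. \<integral>z. dist (fst z) (snd z) powr p \<partial>\<pi>"
  have swap: "?s \<pi> \<in> couplings \<nu> \<mu>" if \<pi>: "\<pi> \<in> couplings \<mu> \<nu>" for \<pi> and \<mu> \<nu> :: "'a measure"
  proof -
    note [measurable_cong] = couplingsD(2)[OF \<pi>]
    show ?thesis
      using distr_in_couplings[OF couplingsD(1)[OF \<pi>], of snd fst] by (simp add: couplingsD[OF \<pi>])
  qed
  have cost: "?c (?s \<pi>) = ?c \<pi>" if \<pi>: "\<pi> \<in> couplings \<mu> \<nu>" for \<pi> and \<mu> \<nu> :: "'a measure"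
  proof -
    note [measurable_cong] = couplingsD(2)[OF \<pi>]
    show ?thesis by (subst integral_distr) (auto simp: dist_commute)
  qed
  have "?c ` couplings \<mu> \<nu> \<subseteq> ?c ` couplings \<nu> \<mu>" for \<mu> \<nu> :: "'a measure"
  proof
    fix c assume "c \<in> ?c ` couplings \<mu> \<nu>"
    then obtain \<pi> where "\<pi> \<in> couplings \<mu> \<nu>" "c = ?c \<pi>" by blast
    then show "c \<in> ?c ` couplings \<nu> \<mu>"
      using cost swap by (intro image_eqI[where x="?s \<pi>"]) auto
  qed
  then have "?c ` couplings \<mu> \<nu> = ?c ` couplings \<nu> \<mu>" by (intro antisym) auto
  then show ?thesis by (simp add: wasserstein_def)
qed

lemma wasserstein_refl:
  assumes p: "0 < p" and \<mu>: "\<mu> \<in> wasserstein_space p"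
  shows "wasserstein p \<mu> \<mu> = 0"
proof -
  note [measurable_cong] = wasserstein_spaceD(2)[OF \<mu>]
  have "distr \<mu> borel (\<lambda>x. x) = \<mu>"
    by (rule distr_id2) (simp add: wasserstein_spaceD[OF \<mu>])
  then have "distr \<mu> borel (\<lambda>x. (x, x)) \<in> couplings \<mu> \<mu>"
    using distr_in_couplings[OF wasserstein_spaceD(1)[OF \<mu>], of "\<lambda>x. x" "\<lambda>x. x"] by simp
  moreover have "(\<integral>z. dist (fst z) (snd z) powr p \<partial>(distr \<mu> borel (\<lambda>x. (x, x)))) = 0"
    by (subst integral_distr) auto
  ultimately have "wasserstein p \<mu> \<mu> \<le> 0"
    using p by (intro wasserstein_le) auto
  then show ?thesis using wasserstein_nonneg[of p \<mu> \<mu>] by simp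
qed

text \<open>
  If all but arbitrarily little mass moves by less than \<open>r\<close>, then \<open>\<mu> C\<close> is at most the \<open>\<nu>\<close>-mass of the
  \<open>r\<close>-neighbourhood of \<open>C\<close>, and these neighbourhoods shrink to \<open>C\<close> because \<open>C\<close> is closed.
\<close>
lemma measure_closed_le_of_wasserstein_zero:
  assumes p: "1 \<le> p" and m: "\<mu> \<in> wasserstein_space p" "\<nu> \<in> wasserstein_space p"
    and zero: "wasserstein p \<mu> \<nu> = 0" and C: "closed C"
  shows "measure \<mu> C \<le> measure \<nu> C"
\<comment> \<open>The distance to the empty set is \<open>0\<close> by convention, so that the neighbourhoods would not shrink.\<close>
proof (cases "C = {}")
  case False
  interpret mu: prob_space \<mu> using m by (simp add: wasserstein_spaceD)
  interpret nu: prob_space \<nu> using m by (simp add: wasserstein_spaceD)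
  note [measurable_cong] = wasserstein_spaceD(2)[OF m(1)] wasserstein_spaceD(2)[OF m(2)]
  have [measurable]: "C \<in> sets borel" using C by simp
  define N where "N r = {x. infdist x C \<le> r}" for r
  have closed_N: "closed (N r)" for r
    unfolding N_def by (intro closed_Collect_le continuous_intros)
  then have [measurable]: "N r \<in> sets borel" for r by simp
  have nbhd: "measure \<mu> C \<le> measure \<nu> (N r)" if r: "0 < r" for r
  proof (rule field_le_epsilon)
    fix e :: real assume e: "0 < e"
    \<comment> \<open>A coupling of cost at most \<open>t powr p\<close> moves, by Markov's inequality, only mass \<open>e\<close> further
      than \<open>r\<close>.\<close>
    define t where "t = r * e powr (1 / p)"
    have t: "0 < t" "t powr p = r powr p * e"
      using r e p by (auto simp: t_def powr_mult powr_powr)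
    obtain \<pi> where \<pi>: "\<pi> \<in> couplings \<mu> \<nu>" "(\<integral>z. dist (fst z) (snd z) powr p \<partial>\<pi>) \<le> t powr p"
      using wasserstein_less_obtain[of p \<mu> \<nu> t] p m t zero by auto
    interpret pi: prob_space \<pi> using couplingsD[OF \<pi>(1)] by simp
    note [measurable_cong] = couplingsD(2)[OF \<pi>(1)]
    have "measure \<pi> {z\<in>space \<pi>. dist (fst z) (snd z) powr p \<ge> r powr p}
        \<le> (\<integral>z. dist (fst z) (snd z) powr p \<partial>\<pi>) / r powr p"
      by (rule integral_Markov_inequality_measure[where A = "{}"])
         (use r integrable_coupling_cost[OF p \<pi>(1) m] in auto)
    also have "\<dots> \<le> e"
      using \<pi>(2) r by (simp add: t(2) divide_le_eq mult.commute)
    finally have far: "measure \<pi> {z\<in>space \<pi>. dist (fst z) (snd z) powr p \<ge> r powr p} \<le> e" .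
    have "measure \<mu> C = measure \<pi> {z\<in>space \<pi>. fst z \<in> C}"
      by (subst couplingsD(3)[OF \<pi>(1), symmetric], subst measure_distr) (auto intro!: arg_cong[where f="measure \<pi>"])
    also have "\<dots> \<le> measure \<pi> ({z\<in>space \<pi>. snd z \<in> N r} \<union> {z\<in>space \<pi>. dist (fst z) (snd z) powr p \<ge> r powr p})"
    proof (rule pi.finite_measure_mono)
      show "{z \<in> space \<pi>. fst z \<in> C} \<subseteq> {z\<in>space \<pi>. snd z \<in> N r} \<union> {z\<in>space \<pi>. dist (fst z) (snd z) powr p \<ge> r powr p}"
      proof (clarsimp simp: N_def)
        fix x y assume "x \<in> C" "\<not> r powr p \<le> dist x y powr p"
        then have "dist x y < r"
          using r p powr_mono2[of p r "dist x y"] by fastforce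
        then show "infdist y C \<le> r"
          using \<open>x \<in> C\<close> by (intro infdist_le2[of x]) (auto simp: dist_commute)
      qed
    qed measurable
    also have "\<dots> \<le> measure \<pi> {z\<in>space \<pi>. snd z \<in> N r} + measure \<pi> {z\<in>space \<pi>. dist (fst z) (snd z) powr p \<ge> r powr p}"
      by (rule measure_Un_le) measurable
    also have "measure \<pi> {z\<in>space \<pi>. snd z \<in> N r} = measure \<nu> (N r)"
      by (subst couplingsD(4)[OF \<pi>(1), symmetric], subst measure_distr) (auto intro!: arg_cong[where f="measure \<pi>"])
    finally show "measure \<mu> C \<le> measure \<nu> (N r) + e" using far by simp
  qed
  have "(\<lambda>i. measure \<nu> (N (1 / Suc i))) \<longlonglongrightarrow> measure \<nu> (\<Inter>i. N (1 / Suc i))"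
  proof (rule nu.finite_Lim_measure_decseq)
    show "decseq (\<lambda>i. N (1 / Suc i))"
      unfolding N_def decseq_def
      by (auto elim!: order_trans intro!: divide_left_mono)
  qed auto
  moreover have "(\<Inter>i. N (1 / Suc i)) = C"
  proof -
    have "x \<in> C" if "\<And>i. infdist x C \<le> 1 / Suc i" for x
    proof (rule ccontr)
      assume "x \<notin> C"
      then have "0 < infdist x C"
        using C False by (intro infdist_pos_not_in_closed) auto
      then obtain i where "1 / Suc i < infdist x C"
        using nat_approx_posE by blast
      then show False using that[of i] by simp
    qed
    then show ?thesis by (auto simp: N_def)
  qed
  ultimately have "(\<lambda>i. measure \<nu> (N (1 / Suc i))) \<longlonglongrightarrow> measure \<nu> C" by simp
  then show ?thesis
    by (rule LIMSEQ_le_const) (auto intro!: nbhd)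
qed simp

lemma wasserstein_eq_0_imp_eq:
  assumes p: "1 \<le> p" and m: "\<mu> \<in> wasserstein_space p" "\<nu> \<in> wasserstein_space p"
    and zero: "wasserstein p \<mu> \<nu> = 0"
  shows "\<mu> = \<nu>"
proof (rule measure_eqI_generator_eq[where E="Collect closed" and \<Omega>=UNIV and A="\<lambda>_. UNIV"])
  interpret mu: prob_space \<mu> using m by (simp add: wasserstein_spaceD)
  interpret nu: prob_space \<nu> using m by (simp add: wasserstein_spaceD)
  show "Int_stable (Collect (closed :: 'a set \<Rightarrow> bool))" by (auto simp: Int_stable_def)
  show "emeasure \<mu> C = emeasure \<nu> C" if "C \<in> Collect closed" for C
    using measure_closed_le_of_wasserstein_zero[OF p m zero, of C]
      measure_closed_le_of_wasserstein_zero[OF p m(2,1), of C] zero that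
    by (simp add: wasserstein_commute[of p \<nu>] mu.emeasure_eq_measure nu.emeasure_eq_measure)
  show "sets \<mu> = sigma_sets UNIV (Collect closed)" "sets \<nu> = sigma_sets UNIV (Collect closed)"
    by (simp_all add: wasserstein_spaceD[OF m(1)] wasserstein_spaceD[OF m(2)] borel_eq_closed)
  show "emeasure \<mu> UNIV \<noteq> \<infinity>" by simp
qed auto

lemma Metric_space_wasserstein:
  assumes "1 \<le> p"
  shows "Metric_space (wasserstein_space p) (wasserstein p :: 'a::euclidean_space measure \<Rightarrow> _)"
proof
  show "wasserstein p \<mu> \<nu> = 0 \<longleftrightarrow> \<mu> = \<nu>"
    if "\<mu> \<in> wasserstein_space p" "\<nu> \<in> wasserstein_space p" for \<mu> \<nu> :: "'a measure"
    using wasserstein_eq_0_imp_eq[OF assms that] wasserstein_refl[OF _ that(1)] assms by auto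
qed (rule wasserstein_nonneg, rule wasserstein_commute, rule wasserstein_triangle[OF assms])

section \<open>Perturbation of a measure along a vector field\<close>
lemma push_in_wasserstein_space:
  assumes p: "1 \<le> p" and \<mu>: "\<mu> \<in> wasserstein_space p" and \<xi>: "\<xi> \<in> Lp_maps p \<mu>"
  shows "push \<mu> \<xi> h \<in> wasserstein_space p"
proof -
  interpret mu: prob_space \<mu> using \<mu> by (simp add: wasserstein_spaceD)
  note [measurable_cong] = wasserstein_spaceD(2)[OF \<mu>]
  have \<xi>_meas[measurable]: "\<xi> \<in> borel_measurable borel"
    and \<xi>_int: "integrable \<mu> (\<lambda>x. norm (\<xi> x) powr p)"
    using \<xi> by (auto simp: Lp_maps_def)
  have "integrable \<mu> (\<lambda>x. \<bar>h\<bar> powr p * norm (\<xi> x) powr p)"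
    using \<xi>_int by simp
  then have "integrable \<mu> (\<lambda>x. norm (h *\<^sub>R \<xi> x) powr p)"
    by (simp add: powr_mult)
  then have sum: "integrable \<mu> (\<lambda>x. (norm x + norm (h *\<^sub>R \<xi> x)) powr p)"
    using p wasserstein_spaceD(3)[OF \<mu>] by (intro integrable_powr_add) auto
  have "integrable \<mu> (\<lambda>x. norm (x + h *\<^sub>R \<xi> x) powr p)"
  proof (rule Bochner_Integration.integrable_bound[OF sum])
    show "AE x in \<mu>. norm (norm (x + h *\<^sub>R \<xi> x) powr p) \<le> norm ((norm x + norm (h *\<^sub>R \<xi> x)) powr p)"
      using p by (intro AE_I2) (auto intro!: powr_mono2 norm_triangle_le simp del: norm_scaleR)
  qed measurable
  then show ?thesis
    unfolding push_def wasserstein_space_def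
    by (auto simp: integrable_distr_eq intro!: mu.prob_space_distr)
qed

lemma wasserstein_push_le:
  assumes p: "1 \<le> p" and \<mu>: "\<mu> \<in> wasserstein_space p" and \<xi>: "\<xi> \<in> Lp_maps p \<mu>" and h: "0 \<le> h"
  shows "wasserstein p \<mu> (push \<mu> \<xi> h) \<le> h * (\<integral>x. norm (\<xi> x) powr p \<partial>\<mu>) powr (1 / p)"
proof -
  note [measurable_cong] = wasserstein_spaceD(2)[OF \<mu>]
  have [measurable]: "\<xi> \<in> borel_measurable borel"
    using \<xi> by (auto simp: Lp_maps_def)
  let ?N = "\<integral>x. norm (\<xi> x) powr p \<partial>\<mu>"
  let ?\<pi> = "distr \<mu> borel (\<lambda>x. (x, x + h *\<^sub>R \<xi> x))"
  have "distr \<mu> borel (\<lambda>x. x) = \<mu>"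
    by (rule distr_id2) (simp add: wasserstein_spaceD[OF \<mu>])
  then have \<pi>: "?\<pi> \<in> couplings \<mu> (push \<mu> \<xi> h)"
    using distr_in_couplings[OF wasserstein_spaceD(1)[OF \<mu>], of "\<lambda>x. x" "\<lambda>x. x + h *\<^sub>R \<xi> x"]
    by (simp add: push_def)
  have "0 \<le> ?N" by (intro integral_nonneg_AE) auto
  then have "(h * ?N powr (1 / p)) powr p = h powr p * ?N"
    using h p by (simp add: powr_mult powr_powr)
  moreover have "(\<integral>z. dist (fst z) (snd z) powr p \<partial>?\<pi>) = (\<integral>x. h powr p * norm (\<xi> x) powr p \<partial>\<mu>)"
    using h by (subst integral_distr) (auto simp: dist_norm powr_mult intro!: Bochner_Integration.integral_cong)
  ultimately show ?thesis
    using p h by (intro wasserstein_le[OF _ \<pi>]) auto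
qed

section \<open>Measures at constant height\<close>
text \<open>
  The product of \<open>\<mu>\<close> with the Dirac mass at \<open>a\<close>. As an image measure it composes directly with
  \<open>push\<close> and with the projections of couplings.
\<close>
abbreviation at_height :: "'a::euclidean_space measure \<Rightarrow> real \<Rightarrow> ('a \<times> real) measure" where
  "at_height \<mu> a \<equiv> distr \<mu> borel (\<lambda>x. (x, a))"

lemma pair_return_eq_at_height:
  assumes "prob_space \<mu>" and \<mu>[measurable_cong]: "sets \<mu> = sets (borel :: 'a::euclidean_space measure)"
  shows "\<mu> \<Otimes>\<^sub>M return borel a = at_height \<mu> a"
proof (rule pair_measure_eqI)
  interpret prob_space \<mu> by fact
  interpret r: prob_space "return borel a" by (rule prob_space_return) simp
  show "sigma_finite_measure \<mu>" "sigma_finite_measure (return borel a)"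
    by unfold_locales
  show "sets (\<mu> \<Otimes>\<^sub>M return borel a) = sets (at_height \<mu> a)"
    using sets_pair_measure_cong[OF \<mu> sets_return[of borel a]] by (simp add: borel_prod[symmetric])
  fix A B assume A: "A \<in> sets \<mu>" and "B \<in> sets (return borel a)"
  then have B: "B \<in> sets borel" by simp
  have "A \<times> B \<in> sets (borel \<Otimes>\<^sub>M borel)"
    using A B by (auto simp: \<mu>)
  then have AB: "A \<times> B \<in> sets borel" by (simp add: borel_prod[symmetric])
  have "emeasure (at_height \<mu> a) (A \<times> B) = emeasure \<mu> ((\<lambda>x. (x, a)) -` (A \<times> B) \<inter> space \<mu>)"
    using AB by (intro emeasure_distr) auto
  also have "(\<lambda>x. (x, a)) -` (A \<times> B) \<inter> space \<mu> = (if a \<in> B then A else {})"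
    using sets.sets_into_space[OF A] by auto
  finally show "emeasure \<mu> A * emeasure (return borel a) B = emeasure (at_height \<mu> a) (A \<times> B)"
    using B by auto
qed

lemma at_height_in_wasserstein_space:
  assumes p: "1 \<le> p" and \<mu>: "\<mu> \<in> wasserstein_space p"
  shows "at_height \<mu> a \<in> wasserstein_space p"
proof -
  interpret mu: prob_space \<mu> using \<mu> by (simp add: wasserstein_spaceD)
  note [measurable_cong] = wasserstein_spaceD(2)[OF \<mu>]
  have sum: "integrable \<mu> (\<lambda>x. (norm x + norm a) powr p)"
    using p wasserstein_spaceD(3)[OF \<mu>] by (intro integrable_powr_add) auto
  have "integrable \<mu> (\<lambda>x. norm (x, a) powr p)"
  proof (rule Bochner_Integration.integrable_bound[OF sum])
    show "AE x in \<mu>. norm (norm (x, a) powr p) \<le> norm ((norm x + norm a) powr p)"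
      using p norm_Pair_le[of _ a] by (intro AE_I2) (auto intro!: powr_mono2)
  qed measurable
  then show ?thesis
    unfolding wasserstein_space_def by (auto simp: integrable_distr_eq intro!: mu.prob_space_distr)
qed

lemma wasserstein_at_height_le:
  assumes p: "1 \<le> p" and m: "\<mu> \<in> wasserstein_space p" "\<nu> \<in> wasserstein_space p"
  shows "wasserstein p (at_height \<mu> a) (at_height \<nu> b) \<le> wasserstein p \<mu> \<nu> + \<bar>a - b\<bar>"
proof (rule field_le_epsilon)
  fix e' :: real assume "0 < e'"
  define e where "e = e' / 2"
  have e: "0 < e" using \<open>0 < e'\<close> by (simp add: e_def)
  define s where "s = wasserstein p \<mu> \<nu> + e"
  define t where "t = \<bar>a - b\<bar> + e"
  have st: "0 < s" "0 < t"
    using e wasserstein_nonneg[of p \<mu> \<nu>] by (auto simp: s_def t_def)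
  obtain \<pi> where \<pi>: "\<pi> \<in> couplings \<mu> \<nu>" "(\<integral>z. dist (fst z) (snd z) powr p \<partial>\<pi>) \<le> s powr p"
    using wasserstein_less_obtain[of p \<mu> \<nu> s] p m e by (auto simp: s_def)
  interpret pi: prob_space \<pi> using couplingsD[OF \<pi>(1)] by simp
  note [measurable_cong] = couplingsD(2)[OF \<pi>(1)]
  let ?\<gamma> = "distr \<pi> borel (\<lambda>z. ((fst z, a), (snd z, b)))"
  have \<gamma>: "?\<gamma> \<in> couplings (at_height \<mu> a) (at_height \<nu> b)"
  proof -
    have "at_height (distr \<pi> borel fst) a = distr \<pi> borel (\<lambda>z. (fst z, a))"
         "at_height (distr \<pi> borel snd) b = distr \<pi> borel (\<lambda>z. (snd z, b))"
      by (simp_all add: distr_distr comp_def)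
    then show ?thesis
      using distr_in_couplings[OF couplingsD(1)[OF \<pi>(1)], of "\<lambda>z. (fst z, a)" "\<lambda>z. (snd z, b)"]
      by (simp add: couplingsD[OF \<pi>(1)])
  qed
  have const: "(\<integral>z. \<bar>a - b\<bar> powr p \<partial>\<pi>) \<le> t powr p"
    using p e by (simp add: pi.prob_space t_def powr_mono2)
  have sum: "integrable \<pi> (\<lambda>z. (dist (fst z) (snd z) + \<bar>a - b\<bar>) powr p)"
      "(\<integral>z. (dist (fst z) (snd z) + \<bar>a - b\<bar>) powr p \<partial>\<pi>) \<le> (s + t) powr p"
    using p \<pi>(2) integrable_coupling_cost[OF p \<pi>(1) m] st const
    by (auto intro!: integrable_powr_add integral_powr_add_le)
  have "(\<integral>z. dist (fst z) (snd z) powr p \<partial>?\<gamma>) = (\<integral>z. dist (fst z, a) (snd z, b) powr p \<partial>\<pi>)"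
    by (subst integral_distr) auto
  also have "\<dots> \<le> (\<integral>z. (dist (fst z) (snd z) + \<bar>a - b\<bar>) powr p \<partial>\<pi>)"
  proof (rule integral_mono_AE[OF _ sum(1)])
    show "AE z in \<pi>. dist (fst z, a) (snd z, b) powr p \<le> (dist (fst z) (snd z) + \<bar>a - b\<bar>) powr p"
      using p by (intro AE_I2 powr_mono2)
        (auto simp: dist_Pair_Pair dist_real_def intro!: order_trans[OF sqrt_sum_squares_le_sum_abs])
    have "integrable ?\<gamma> (\<lambda>z. dist (fst z) (snd z) powr p)"
      by (intro integrable_coupling_cost[OF p \<gamma>] at_height_in_wasserstein_space p m)
    then show "integrable \<pi> (\<lambda>z. dist (fst z, a) (snd z, b) powr p)"
      by (simp add: integrable_distr_eq)
  qed
  also note sum(2)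
  finally have "wasserstein p (at_height \<mu> a) (at_height \<nu> b) \<le> s + t"
    using p st by (intro wasserstein_le[OF _ \<gamma>]) auto
  then show "wasserstein p (at_height \<mu> a) (at_height \<nu> b) \<le> wasserstein p \<mu> \<nu> + \<bar>a - b\<bar> + e'"
    by (simp add: s_def t_def e_def)
qed

text \<open>
  A coupling of the two lifted measures projects to a coupling of \<open>\<mu>\<close> and \<open>\<nu>\<close> that costs no more, and
  under it the heights are almost surely \<open>a\<close> and \<open>b\<close>, so that the cost is at least \<open>\<bar>a - b\<bar> powr p\<close>.
\<close>
lemma wasserstein_at_height_ge:
  assumes p: "1 \<le> p" and m: "\<mu> \<in> wasserstein_space p" "\<nu> \<in> wasserstein_space p"
  shows "wasserstein p \<mu> \<nu> \<le> wasserstein p (at_height \<mu> a) (at_height \<nu> b)"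
    and "\<bar>a - b\<bar> \<le> wasserstein p (at_height \<mu> a) (at_height \<nu> b)"
proof -
  have main: "wasserstein p \<mu> \<nu> \<le> t \<and> \<bar>a - b\<bar> \<le> t"
    if less: "wasserstein p (at_height \<mu> a) (at_height \<nu> b) < t" for t
  proof -
    have t: "0 < t" using less wasserstein_nonneg[of p "at_height \<mu> a" "at_height \<nu> b"] by linarith
    note mu[measurable_cong] = wasserstein_spaceD(2)[OF m(1)]
    note nu[measurable_cong] = wasserstein_spaceD(2)[OF m(2)]
    have M: "at_height \<mu> a \<in> wasserstein_space p" "at_height \<nu> b \<in> wasserstein_space p"
      using p m by (auto intro: at_height_in_wasserstein_space)
    obtain \<pi> where \<pi>: "\<pi> \<in> couplings (at_height \<mu> a) (at_height \<nu> b)"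
      and le: "(\<integral>z. dist (fst z) (snd z) powr p \<partial>\<pi>) \<le> t powr p"
      using wasserstein_less_obtain[OF _ M less] p by auto
    interpret pi: prob_space \<pi> using couplingsD[OF \<pi>] by simp
    note [measurable_cong] = couplingsD(2)[OF \<pi>]
    note int = integrable_coupling_cost[OF p \<pi> M]
    let ?\<gamma> = "distr \<pi> borel (\<lambda>w. (fst (fst w), fst (snd w)))"
    have \<gamma>: "?\<gamma> \<in> couplings \<mu> \<nu>"
    proof -
      have "distr (at_height \<mu> a) borel fst = \<mu>" "distr (at_height \<nu> b) borel fst = \<nu>"
        by (simp_all add: distr_distr comp_def distr_id2 mu nu)
      moreover have "distr (distr \<pi> borel fst) borel fst = distr \<pi> borel (\<lambda>w. fst (fst w))"
        "distr (distr \<pi> borel snd) borel fst = distr \<pi> borel (\<lambda>w. fst (snd w))"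
        by (simp_all add: distr_distr comp_def)
      ultimately show ?thesis
        using distr_in_couplings[OF couplingsD(1)[OF \<pi>], of "\<lambda>w. fst (fst w)" "\<lambda>w. fst (snd w)"]
        by (simp add: couplingsD[OF \<pi>])
    qed
    have "(\<integral>z. dist (fst z) (snd z) powr p \<partial>?\<gamma>) = (\<integral>w. dist (fst (fst w)) (fst (snd w)) powr p \<partial>\<pi>)"
      by (subst integral_distr) auto
    also have "\<dots> \<le> (\<integral>z. dist (fst z) (snd z) powr p \<partial>\<pi>)"
    proof (rule integral_mono[OF _ int])
      have "integrable ?\<gamma> (\<lambda>z. dist (fst z) (snd z) powr p)"
        by (rule integrable_coupling_cost[OF p \<gamma> m])
      then show "integrable \<pi> (\<lambda>w. dist (fst (fst w)) (fst (snd w)) powr p)"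
        by (simp add: integrable_distr_eq)
    qed (use p in \<open>auto intro!: powr_mono2 dist_fst_le\<close>)
    also note le
    finally have 1: "wasserstein p \<mu> \<nu> \<le> t"
      using p t by (intro wasserstein_le[OF _ \<gamma>]) auto
    have "AE z in at_height \<mu> a. snd z = a" "AE z in at_height \<nu> b. snd z = b"
      by (simp_all add: AE_distr_iff)
    then have "AE z in distr \<pi> borel fst. snd z = a" "AE z in distr \<pi> borel snd. snd z = b"
      by (simp_all only: couplingsD(3,4)[OF \<pi>])
    moreover have "fst \<in> borel_measurable \<pi>" "snd \<in> borel_measurable \<pi>"
      by measurable
    ultimately have "AE w in \<pi>. snd (fst w) = a" "AE w in \<pi>. snd (snd w) = b"
      by (blast dest: AE_distrD)+
    then have "AE w in \<pi>. \<bar>a - b\<bar> powr p \<le> dist (fst w) (snd w) powr p"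
    proof eventually_elim
      case (elim w)
      then have "\<bar>a - b\<bar> = dist (snd (fst w)) (snd (snd w))"
        by (simp add: dist_real_def)
      also have "\<dots> \<le> dist (fst w) (snd w)"
        by (rule dist_snd_le)
      finally show ?case
        using p by (intro powr_mono2) auto
    qed
    then have "(\<integral>w. \<bar>a - b\<bar> powr p \<partial>\<pi>) \<le> (\<integral>w. dist (fst w) (snd w) powr p \<partial>\<pi>)"
      by (intro integral_mono_AE int) auto
    then have "\<bar>a - b\<bar> powr p \<le> t powr p"
      using le by (simp add: pi.prob_space)
    then have "\<bar>a - b\<bar> \<le> t"
      using p t powr_less_mono2[of p t "\<bar>a - b\<bar>"] by linarith
    with 1 show ?thesis by simp
  qed
  show "wasserstein p \<mu> \<nu> \<le> wasserstein p (at_height \<mu> a) (at_height \<nu> b)"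
    by (rule dense_ge) (use main in blast)
  show "\<bar>a - b\<bar> \<le> wasserstein p (at_height \<mu> a) (at_height \<nu> b)"
    by (rule dense_ge) (use main in blast)
qed

text \<open>
  A point of the epigraph determines its base and its height, so that \<open>W \<mu> \<le> \<alpha>\<close> can be read off from
  membership of the product measure.
\<close>
lemma at_height_inject:
  assumes p: "1 \<le> p" and m: "\<mu> \<in> wasserstein_space p" "\<nu> \<in> wasserstein_space p"
    and eq: "at_height \<mu> a = at_height \<nu> b"
  shows "\<mu> = \<nu>" "a = b"
proof -
  have "wasserstein p (at_height \<mu> a) (at_height \<nu> b) = 0"
    using p m unfolding eq by (intro wasserstein_refl at_height_in_wasserstein_space) auto
  then show "\<mu> = \<nu>" "a = b"
    using wasserstein_at_height_ge[OF p m, of a b] wasserstein_nonneg[of p \<mu> \<nu>]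
    by (auto intro!: wasserstein_eq_0_imp_eq[OF p m])
qed

lemma push_at_height:
  assumes "sets \<mu> = sets borel" "\<xi> \<in> borel_measurable borel"
  shows "push (at_height \<mu> a) (\<lambda>(x, a). (\<xi> x, \<rho>)) h = at_height (push \<mu> \<xi> h) (a + h * \<rho>)"
proof -
  note [measurable_cong] = assms(1)
  note [measurable] = assms(2)
  show ?thesis
    unfolding push_def case_prod_beta' by (simp add: distr_distr comp_def)
qed

lemma constant_speed_in_Lp_maps:
  assumes p: "1 \<le> p" and \<mu>: "\<mu> \<in> wasserstein_space p" and \<xi>: "\<xi> \<in> Lp_maps p \<mu>"
  shows "(\<lambda>(x, a). (\<xi> x, \<rho>)) \<in> Lp_maps p (at_height \<mu> \<alpha>)"
proof -
  interpret mu: prob_space \<mu> using \<mu> by (simp add: wasserstein_spaceD)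
  note [measurable_cong] = wasserstein_spaceD(2)[OF \<mu>]
  have \<xi>_meas[measurable]: "\<xi> \<in> borel_measurable borel"
    and \<xi>_int: "integrable \<mu> (\<lambda>x. norm (\<xi> x) powr p)"
    using \<xi> by (auto simp: Lp_maps_def)
  have sum: "integrable \<mu> (\<lambda>x. (norm (\<xi> x) + norm \<rho>) powr p)"
    using p \<xi>_int by (intro integrable_powr_add) auto
  have "integrable \<mu> (\<lambda>x. norm (\<xi> x, \<rho>) powr p)"
  proof (rule Bochner_Integration.integrable_bound[OF sum])
    show "AE x in \<mu>. norm (norm (\<xi> x, \<rho>) powr p) \<le> norm ((norm (\<xi> x) + norm \<rho>) powr p)"
      using p norm_Pair_le[of _ \<rho>] by (intro AE_I2) (auto intro!: powr_mono2)
  qed measurable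
  then show ?thesis
    unfolding Lp_maps_def case_prod_beta' by (auto simp: integrable_distr_eq)
qed

section \<open>Contingent cones through good step sizes\<close>
lemma frequently_at_right_0E:
  fixes d :: real
  assumes "\<exists>\<^sub>F h in at_right 0. P h" "0 < d"
  obtains h where "0 < h" "h < d" "P h"
proof -
  have "\<exists>\<^sub>F h in at_right 0. P h \<and> h \<in> {0<..<d}"
    by (rule frequently_eventually_frequently[OF assms(1) eventually_at_right_real[OF assms(2)]])
  then show thesis
    using that by (auto dest!: frequently_ex)
qed

lemma Liminf_eq_0_iff:
  fixes f :: "real \<Rightarrow> real"
  assumes "\<forall>\<^sub>F h in at_right 0. 0 \<le> f h"
  shows "Liminf (at_right 0) (\<lambda>h. ereal (f h)) = 0 \<longleftrightarrow> (\<forall>e>0. \<exists>\<^sub>F h in at_right 0. f h < e)"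
proof -
  have "0 \<le> Liminf (at_right 0) (\<lambda>h. ereal (f h))"
    using assms by (intro Liminf_bounded) simp
  then have "Liminf (at_right 0) (\<lambda>h. ereal (f h)) = 0 \<longleftrightarrow> Liminf (at_right 0) (\<lambda>h. ereal (f h)) \<le> 0"
    by (auto intro: order_antisym)
  also have "\<dots> \<longleftrightarrow> (\<forall>e>0. \<exists>\<^sub>F h in at_right 0. f h < e)"
  proof (intro iffI allI impI)
    fix e :: real assume L: "Liminf (at_right 0) (\<lambda>h. ereal (f h)) \<le> 0" and e: "0 < e"
    show "\<exists>\<^sub>F h in at_right 0. f h < e"
    proof (rule ccontr)
      assume "\<not> ?thesis"
      then have "\<forall>\<^sub>F h in at_right 0. ereal e \<le> ereal (f h)"
        unfolding frequently_def by (simp add: not_less)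
      then have "ereal e \<le> Liminf (at_right 0) (\<lambda>h. ereal (f h))"
        by (rule Liminf_bounded)
      then have "ereal e \<le> 0"
        using L by (rule order_trans)
      with e show False by simp
    qed
  next
    assume small: "\<forall>e>0. \<exists>\<^sub>F h in at_right 0. f h < e"
    show "Liminf (at_right 0) (\<lambda>h. ereal (f h)) \<le> 0"
    proof (rule ccontr)
      assume "\<not> ?thesis"
      then have "0 < Liminf (at_right 0) (\<lambda>h. ereal (f h))"
        by (simp only: not_le)
      from ereal_dense2[OF this]
      obtain e where e: "0 < ereal e" "ereal e < Liminf (at_right 0) (\<lambda>h. ereal (f h))"
        by blast
      have "\<forall>\<^sub>F h in at_right 0. ereal e < ereal (f h)"
        using e(2) by (rule less_LiminfD)
      moreover have "\<exists>\<^sub>F h in at_right 0. f h < e"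
        using small e(1) by simp
      ultimately have "\<exists>\<^sub>F h in at_right 0. f h < e \<and> ereal e < ereal (f h)"
        by (rule frequently_eventually_frequently[rotated])
      then obtain h where "f h < e" "ereal e < ereal (f h)"
        using frequently_ex by blast
      then show False by simp
    qed
  qed
  finally show ?thesis .
qed

text \<open>
  The rescaled distances are nonnegative, so their lower limit vanishes iff they are frequently below
  each \<open>e > 0\<close>; a strict bound on the infimum over \<open>Q\<close> is witnessed by a point of \<open>Q\<close>.
\<close>
lemma contingent_cone_iff:
  assumes "Q \<noteq> {}"
  shows "\<xi> \<in> contingent_cone p Q \<mu> \<longleftrightarrow> \<xi> \<in> Lp_maps p \<mu> \<and>
    (\<forall>e>0. \<exists>\<^sub>F h in at_right 0. \<exists>\<sigma>\<in>Q. wasserstein p (push \<mu> \<xi> h) \<sigma> < e * h)"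
proof -
  let ?d = "\<lambda>h. INF \<sigma>\<in>Q. wasserstein p (push \<mu> \<xi> h) \<sigma>"
  have pos: "\<forall>\<^sub>F h::real in at_right 0. 0 < h"
    by (rule eventually_at_right_less)
  have "0 \<le> ?d h" for h
    using assms by (intro cINF_greatest wasserstein_nonneg)
  then have "Liminf (at_right 0) (\<lambda>h. ereal (1 / h * ?d h)) = 0
      \<longleftrightarrow> (\<forall>e>0. \<exists>\<^sub>F h in at_right 0. 1 / h * ?d h < e)"
    by (intro Liminf_eq_0_iff eventually_mono[OF pos]) auto
  moreover have "(\<exists>\<^sub>F h in at_right 0. 1 / h * ?d h < e) \<longleftrightarrow>
      (\<exists>\<^sub>F h in at_right 0. \<exists>\<sigma>\<in>Q. wasserstein p (push \<mu> \<xi> h) \<sigma> < e * h)" for e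
  proof (rule frequently_cong[OF pos])
    fix h :: real assume "0 < h"
    then have "1 / h * ?d h < e \<longleftrightarrow> ?d h < e * h"
      by (simp add: divide_less_eq)
    also have "\<dots> \<longleftrightarrow> (\<exists>\<sigma>\<in>Q. wasserstein p (push \<mu> \<xi> h) \<sigma> < e * h)"
      by (rule cINF_less_iff[OF assms]) (auto intro!: bdd_belowI[of _ 0] wasserstein_nonneg)
    finally show "1 / h * ?d h < e \<longleftrightarrow> (\<exists>\<sigma>\<in>Q. wasserstein p (push \<mu> \<xi> h) \<sigma> < e * h)" .
  qed
  ultimately show ?thesis
    by (simp add: contingent_cone_def)
qed

section \<open>Slopes and the epigraph\<close>
text \<open>
  The common description of the contingent cone of the epigraph and of the lower directional
  derivative: \<open>\<rho>\<close> is compared with the slope of a line that starts at height \<open>\<alpha>\<close>. The same \<open>e\<close> bounds the distance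
  and relaxes the slope because the distance between lifted measures controls both errors at once.
\<close>
definition slope_attainable ::
    "real \<Rightarrow> ('a::euclidean_space measure \<Rightarrow> ereal) \<Rightarrow> 'a measure \<Rightarrow> real \<Rightarrow> ('a \<Rightarrow> 'a) \<Rightarrow> real \<Rightarrow> bool" where
  "slope_attainable p W \<mu> \<alpha> \<xi> \<rho> \<longleftrightarrow>
     (\<forall>e>0. \<exists>\<^sub>F h in at_right 0. \<exists>\<nu>\<in>effective_domain p W.
        wasserstein p (push \<mu> \<xi> h) \<nu> < e * h \<and> W \<nu> < ereal (\<alpha> + h * (\<rho> + e)))"

lemma epigraph_set_eq:
  fixes W :: "'a::euclidean_space measure \<Rightarrow> ereal"
  assumes "1 \<le> p"
  shows "epigraph_set p W = {at_height \<nu> b | \<nu> b. \<nu> \<in> wasserstein_space p \<and> W \<nu> \<le> ereal b}"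
proof -
  have prod: "\<nu> \<Otimes>\<^sub>M return borel b = at_height \<nu> b" if "\<nu> \<in> wasserstein_space p" for \<nu> :: "'a measure" and b
    using wasserstein_spaceD(1,2)[OF that] by (rule pair_return_eq_at_height)
  show ?thesis
  proof (intro set_eqI iffI)
    fix M assume "M \<in> epigraph_set p W"
    then obtain \<nu> b where "M = \<nu> \<Otimes>\<^sub>M return borel b" "\<nu> \<in> wasserstein_space p" "W \<nu> \<le> ereal b"
      unfolding epigraph_set_def by blast
    then show "M \<in> {at_height \<nu> b | \<nu> b. \<nu> \<in> wasserstein_space p \<and> W \<nu> \<le> ereal b}"
      using prod by blast
  next
    fix M assume "M \<in> {at_height \<nu> b | \<nu> b. \<nu> \<in> wasserstein_space p \<and> W \<nu> \<le> ereal b}"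
    then obtain \<nu> b where "M = at_height \<nu> b" "\<nu> \<in> wasserstein_space p" "W \<nu> \<le> ereal b"
      by blast
    then show "M \<in> epigraph_set p W"
      unfolding epigraph_set_def using prod[symmetric] at_height_in_wasserstein_space[OF assms] by blast
  qed
qed

text \<open>
  The step \<open>h\<close> sends the measure at height \<open>\<alpha>\<close> to the measure \<open>push \<mu> \<xi> h\<close> at height \<open>\<alpha> + h * \<rho>\<close>.
  A point of the epigraph within \<open>e * h\<close> of it has its base within \<open>e * h\<close> of \<open>push \<mu> \<xi> h\<close> and its
  height, which dominates \<open>W\<close>, below \<open>\<alpha> + h * (\<rho> + e)\<close>. Conversely a measure with these properties
  for \<open>e / 2\<close>, lifted to the height \<open>\<alpha> + h * (\<rho> + e / 2)\<close>, is in the epigraph and within \<open>e * h\<close>.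
\<close>
lemma contingent_cone_epigraph_iff:
  assumes p: "1 \<le> p" and \<mu>: "\<mu> \<in> wasserstein_space p" and \<xi>: "\<xi> \<in> Lp_maps p \<mu>"
    and \<alpha>: "W \<mu> \<le> ereal \<alpha>"
  shows "(\<lambda>(x, a). (\<xi> x, \<rho>)) \<in> contingent_cone p (epigraph_set p W) (at_height \<mu> \<alpha>) \<longleftrightarrow>
    slope_attainable p W \<mu> \<alpha> \<xi> \<rho>"
proof -
  let ?v = "\<lambda>(x, a::real). (\<xi> x, \<rho>)"
  have ne: "epigraph_set p W \<noteq> {}"
    using \<mu> \<alpha> by (auto simp: epigraph_set_eq[OF p])
  have v: "?v \<in> Lp_maps p (at_height \<mu> \<alpha>)"
    using p \<mu> \<xi> by (rule constant_speed_in_Lp_maps)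
  have push: "push (at_height \<mu> \<alpha>) ?v h = at_height (push \<mu> \<xi> h) (\<alpha> + h * \<rho>)" for h
    using \<xi> by (intro push_at_height) (auto simp: wasserstein_spaceD[OF \<mu>] Lp_maps_def)
  have push_space: "push \<mu> \<xi> h \<in> wasserstein_space p" for h
    using p \<mu> \<xi> by (rule push_in_wasserstein_space)
  have pos: "\<forall>\<^sub>F h::real in at_right 0. 0 < h"
    by (rule eventually_at_right_less)
  have cone: "?v \<in> contingent_cone p (epigraph_set p W) (at_height \<mu> \<alpha>) \<longleftrightarrow>
      (\<forall>e>0. \<exists>\<^sub>F h in at_right 0. \<exists>\<nu> b. \<nu> \<in> wasserstein_space p \<and> W \<nu> \<le> ereal b \<and>
         wasserstein p (at_height (push \<mu> \<xi> h) (\<alpha> + h * \<rho>)) (at_height \<nu> b) < e * h)"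
  proof -
    have "(\<exists>\<sigma>\<in>epigraph_set p W. R \<sigma>) \<longleftrightarrow>
        (\<exists>\<nu> b. \<nu> \<in> wasserstein_space p \<and> W \<nu> \<le> ereal b \<and> R (at_height \<nu> b))" for R
      unfolding epigraph_set_eq[OF p] by blast
    then show ?thesis
      unfolding contingent_cone_iff[OF ne] push using v by (simp only: simp_thms)
  qed
  show ?thesis
    unfolding cone slope_attainable_def
  proof (intro iffI allI impI)
    fix e :: real assume e: "0 < e"
      and near: "\<forall>e>0. \<exists>\<^sub>F h in at_right 0. \<exists>\<nu> b. \<nu> \<in> wasserstein_space p \<and> W \<nu> \<le> ereal b \<and>
         wasserstein p (at_height (push \<mu> \<xi> h) (\<alpha> + h * \<rho>)) (at_height \<nu> b) < e * h"
    from near[rule_format, OF e]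
    show "\<exists>\<^sub>F h in at_right 0. \<exists>\<nu>\<in>effective_domain p W.
        wasserstein p (push \<mu> \<xi> h) \<nu> < e * h \<and> W \<nu> < ereal (\<alpha> + h * (\<rho> + e))"
    proof (rule frequently_elim1, elim exE conjE)
      fix h \<nu> b
      assume \<nu>: "\<nu> \<in> wasserstein_space p" and b: "W \<nu> \<le> ereal b"
        and less: "wasserstein p (at_height (push \<mu> \<xi> h) (\<alpha> + h * \<rho>)) (at_height \<nu> b) < e * h"
      have "b < \<alpha> + h * (\<rho> + e)" and close: "wasserstein p (push \<mu> \<xi> h) \<nu> < e * h"
        using less wasserstein_at_height_ge[OF p push_space[of h] \<nu>, of "\<alpha> + h * \<rho>" b]
        by (auto simp: algebra_simps)
      then have "W \<nu> < ereal (\<alpha> + h * (\<rho> + e))"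
        using b by (metis ereal_less(1) le_less_trans less_ereal.simps(1))
      moreover from this have "\<nu> \<in> effective_domain p W"
        using \<nu> by (auto simp: effective_domain_def)
      ultimately show "\<exists>\<nu>\<in>effective_domain p W.
          wasserstein p (push \<mu> \<xi> h) \<nu> < e * h \<and> W \<nu> < ereal (\<alpha> + h * (\<rho> + e))"
        using close by blast
    qed
  next
    fix e :: real assume e: "0 < e"
      and near: "\<forall>e>0. \<exists>\<^sub>F h in at_right 0. \<exists>\<nu>\<in>effective_domain p W.
        wasserstein p (push \<mu> \<xi> h) \<nu> < e * h \<and> W \<nu> < ereal (\<alpha> + h * (\<rho> + e))"
    have "\<exists>\<^sub>F h in at_right 0. (\<exists>\<nu>\<in>effective_domain p W.
        wasserstein p (push \<mu> \<xi> h) \<nu> < e / 2 * h \<and> W \<nu> < ereal (\<alpha> + h * (\<rho> + e / 2))) \<and> 0 < h"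
      using e by (intro frequently_eventually_frequently[OF near[rule_format] pos]) simp
    then show "\<exists>\<^sub>F h in at_right 0. \<exists>\<nu> b. \<nu> \<in> wasserstein_space p \<and> W \<nu> \<le> ereal b \<and>
         wasserstein p (at_height (push \<mu> \<xi> h) (\<alpha> + h * \<rho>)) (at_height \<nu> b) < e * h"
    proof (rule frequently_elim1, elim exE conjE bexE)
      fix h :: real and \<nu>
      assume h: "0 < h" and \<nu>: "\<nu> \<in> effective_domain p W"
        and close: "wasserstein p (push \<mu> \<xi> h) \<nu> < e / 2 * h"
        and W: "W \<nu> < ereal (\<alpha> + h * (\<rho> + e / 2))"
      let ?b = "\<alpha> + h * (\<rho> + e / 2)"
      have \<nu>_space: "\<nu> \<in> wasserstein_space p" using \<nu> by (simp add: effective_domain_def)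
      have "wasserstein p (at_height (push \<mu> \<xi> h) (\<alpha> + h * \<rho>)) (at_height \<nu> ?b)
          \<le> wasserstein p (push \<mu> \<xi> h) \<nu> + \<bar>\<alpha> + h * \<rho> - ?b\<bar>"
        by (rule wasserstein_at_height_le[OF p push_space \<nu>_space])
      also have "\<bar>\<alpha> + h * \<rho> - ?b\<bar> = e / 2 * h"
        using h e by (simp add: algebra_simps)
      also have "wasserstein p (push \<mu> \<xi> h) \<nu> + e / 2 * h < e * h"
        using close by simp
      finally show "\<exists>\<nu> b. \<nu> \<in> wasserstein_space p \<and> W \<nu> \<le> ereal b \<and>
         wasserstein p (at_height (push \<mu> \<xi> h) (\<alpha> + h * \<rho>)) (at_height \<nu> b) < e * h"
        using \<nu>_space W by (intro exI[of _ \<nu>] exI[of _ ?b]) auto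
    qed
  qed
qed

lemma slope_attainable_imp_contingent:
  assumes \<mu>: "\<mu> \<in> effective_domain p W" and \<xi>: "\<xi> \<in> Lp_maps p \<mu>"
    and slope: "slope_attainable p W \<mu> \<alpha> \<xi> \<rho>"
  shows "\<xi> \<in> contingent_cone p (effective_domain p W) \<mu>"
proof -
  have "effective_domain p W \<noteq> {}" using \<mu> by blast
  moreover have "\<exists>\<^sub>F h in at_right 0. \<exists>\<sigma>\<in>effective_domain p W. wasserstein p (push \<mu> \<xi> h) \<sigma> < e * h"
    if "0 < e" for e
    using slope that unfolding slope_attainable_def by (auto elim!: allE[of _ e] frequently_elim1)
  ultimately show ?thesis
    using \<xi> by (simp add: contingent_cone_iff)
qed

lemma ereal_difference_quotient_less_iff:
  fixes x :: ereal and w h r :: real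
  assumes "0 < h" "\<bar>x\<bar> \<noteq> \<infinity>"
  shows "(x - ereal w) / ereal h < ereal r \<longleftrightarrow> x < ereal (w + h * r)"
proof -
  obtain y where "x = ereal y"
    using assms(2) by auto
  moreover have "(y - w) / h < r \<longleftrightarrow> y < w + h * r"
    using assms(1) by (auto simp: pos_divide_less_eq mult.commute)
  ultimately show ?thesis
    using assms(1) by simp
qed

text \<open>
  For \<open>\<nu>\<close> in the domain, the difference quotient is below \<open>\<rho> + e\<close> exactly when \<open>W \<nu>\<close> is below the
  line of slope \<open>\<rho> + e\<close> from \<open>W \<mu>\<close>. A sequence that nearly realizes the infimum therefore has terms
  witnessing each \<open>e\<close>, and witnesses for \<open>e = 1 / Suc i\<close> form a sequence of quotients with lower
  limit at most \<open>\<rho>\<close>.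
\<close>
lemma lower_dir_deriv_le_iff:
  assumes W: "\<And>\<nu>. \<nu> \<in> wasserstein_space p \<Longrightarrow> W \<nu> \<noteq> -\<infinity>" and w: "W \<mu> = ereal w"
  shows "lower_dir_deriv p W \<mu> \<xi> \<le> ereal \<rho> \<longleftrightarrow> slope_attainable p W \<mu> w \<xi> \<rho>"
proof -
  have quot: "(W \<nu> - W \<mu>) / ereal h < ereal r \<longleftrightarrow> W \<nu> < ereal (w + h * r)"
    if "0 < h" "\<nu> \<in> effective_domain p W" for \<nu> h r
    using that W[of \<nu>] unfolding w
    by (intro ereal_difference_quotient_less_iff) (auto simp: effective_domain_def)
  show ?thesis
  proof
    assume D: "lower_dir_deriv p W \<mu> \<xi> \<le> ereal \<rho>"
    show "slope_attainable p W \<mu> w \<xi> \<rho>"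
      unfolding slope_attainable_def
    proof (intro allI impI)
      fix e :: real assume e: "0 < e"
      have "lower_dir_deriv p W \<mu> \<xi> < ereal (\<rho> + e)"
        using D e by (metis ereal_less_eq(3) le_less_trans less_add_same_cancel1 less_ereal.simps(1))
      then obtain h m where h: "\<And>i. 0 < h i" "h \<longlonglongrightarrow> 0" and m: "\<And>i. m i \<in> effective_domain p W"
        and o: "(\<lambda>i. wasserstein p (push \<mu> \<xi> (h i)) (m i)) \<in> o(h)"
        and lim: "liminf (\<lambda>i::nat. (W (m i) - W \<mu>) / ereal (h i)) < ereal (\<rho> + e)"
        unfolding lower_dir_deriv_def Inf_less_iff by auto
      have freq: "\<exists>\<^sub>F i in sequentially. (W (m i) - W \<mu>) / ereal (h i) < ereal (\<rho> + e)"
      proof (rule ccontr)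
        assume "\<not> ?thesis"
        then have "\<forall>\<^sub>F i in sequentially. ereal (\<rho> + e) \<le> (W (m i) - W \<mu>) / ereal (h i)"
          unfolding frequently_def by (simp add: not_less)
        then have "ereal (\<rho> + e) \<le> liminf (\<lambda>i. (W (m i) - W \<mu>) / ereal (h i))"
          by (rule Liminf_bounded)
        with lim show False by simp
      qed
      have ev: "\<forall>\<^sub>F i in sequentially. wasserstein p (push \<mu> \<xi> (h i)) (m i) < e * h i"
        \<comment> \<open>Half of \<open>e\<close> turns the weak inequality of the Landau symbol into a strict one.\<close>
        using landau_o.smallD[OF o, of "e / 2"] e
      proof (simp, elim eventually_mono)
        fix i assume "\<bar>wasserstein p (push \<mu> \<xi> (h i)) (m i)\<bar> * 2 \<le> e * \<bar>h i\<bar>"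
        moreover have "0 < e * h i" using e h(1)[of i] by simp
        ultimately show "wasserstein p (push \<mu> \<xi> (h i)) (m i) < e * h i"
          using wasserstein_nonneg[of p "push \<mu> \<xi> (h i)" "m i"] h(1)[of i] by simp
      qed
      let ?P = "\<lambda>h. \<exists>\<nu>\<in>effective_domain p W.
        wasserstein p (push \<mu> \<xi> h) \<nu> < e * h \<and> W \<nu> < ereal (w + h * (\<rho> + e))"
      have P: "\<exists>\<^sub>F i in sequentially. ?P (h i)"
        using frequently_eventually_frequently[OF freq ev]
        by (rule frequently_elim1) (use h(1) m quot in blast)
      have "filterlim h (at_right 0) sequentially"
        using h by (intro tendsto_imp_filterlim_at_right always_eventually) auto
      then show "\<exists>\<^sub>F h in at_right 0. ?P h"
        using P eventually_compose_filterlim[of "\<lambda>h. \<not> ?P h" "at_right 0" h sequentially]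
        unfolding frequently_def by blast
    qed
  next
    assume slope: "slope_attainable p W \<mu> w \<xi> \<rho>"
    have "\<exists>h \<nu>. 0 < h \<and> h < 1 / Suc i \<and> \<nu> \<in> effective_domain p W \<and>
        wasserstein p (push \<mu> \<xi> h) \<nu> < 1 / Suc i * h \<and> W \<nu> < ereal (w + h * (\<rho> + 1 / Suc i))" for i
    proof -
      have i: "(0::real) < 1 / Suc i" by simp
      show ?thesis
        by (rule frequently_at_right_0E[OF slope[unfolded slope_attainable_def, rule_format, OF i] i]) blast
    qed
    then obtain h m where h: "\<And>i. 0 < h i" "\<And>i. h i < 1 / Suc i"
      and m: "\<And>i. m i \<in> effective_domain p W"
      and close: "\<And>i. wasserstein p (push \<mu> \<xi> (h i)) (m i) < 1 / Suc i * h i"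
      and low: "\<And>i. W (m i) < ereal (w + h i * (\<rho> + 1 / Suc i))"
      by metis
    have inv: "(\<lambda>i. 1 / real (Suc i)) \<longlonglongrightarrow> 0"
      by (rule LIMSEQ_Suc[OF lim_1_over_n])
    have h0: "h \<longlonglongrightarrow> 0"
      by (rule tendsto_sandwich[OF _ _ tendsto_const inv]) (intro always_eventually allI less_imp_le h)+
    have o: "(\<lambda>i. wasserstein p (push \<mu> \<xi> (h i)) (m i)) \<in> o(h)"
    proof (rule landau_o.smallI)
      fix c :: real assume "0 < c"
      then have "\<forall>\<^sub>F i in sequentially. 1 / real (Suc i) < c"
        using order_tendstoD(2)[OF inv] by blast
      then show "\<forall>\<^sub>F i in sequentially. norm (wasserstein p (push \<mu> \<xi> (h i)) (m i)) \<le> c * norm (h i)"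
      proof eventually_elim
        case (elim i)
        have "wasserstein p (push \<mu> \<xi> (h i)) (m i) \<le> 1 / Suc i * h i"
          using close[of i] by simp
        also have "\<dots> \<le> c * h i"
          using elim h(1)[of i] by (intro mult_right_mono) auto
        finally show ?case
          using h(1)[of i] wasserstein_nonneg[of p "push \<mu> \<xi> (h i)" "m i"] by simp
      qed
    qed
    have "lower_dir_deriv p W \<mu> \<xi> \<le> liminf (\<lambda>i. (W (m i) - W \<mu>) / ereal (h i))"
      unfolding lower_dir_deriv_def using h(1) h0 m o by (intro Inf_lower) blast
    also have "\<dots> \<le> liminf (\<lambda>i. ereal (\<rho> + 1 / Suc i))"
      using quot[OF h(1) m] low by (intro Liminf_mono always_eventually allI less_imp_le) blast
    also have "\<dots> = ereal \<rho>"
    proof (rule lim_imp_Liminf)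
      have "(\<lambda>i. \<rho> + 1 / real (Suc i)) \<longlonglongrightarrow> \<rho> + 0"
        by (intro tendsto_intros inv)
      then show "(\<lambda>i. ereal (\<rho> + 1 / Suc i)) \<longlonglongrightarrow> ereal \<rho>" by simp
    qed simp
    finally show "lower_dir_deriv p W \<mu> \<xi> \<le> ereal \<rho>" .
  qed
qed

text \<open>
  As the Wasserstein distance is a metric, every neighbourhood of \<open>\<mu>\<close> in \<open>wasserstein_topology\<close>
  contains a ball.
\<close>
lemma continuous_over_domain_less_nearby:
  assumes p: "1 \<le> p" and cont: "continuous_over_domain p W"
    and \<mu>: "\<mu> \<in> effective_domain p W" and c: "W \<mu> < c"
  obtains r where "0 < r" "\<And>\<nu>. \<nu> \<in> effective_domain p W \<Longrightarrow> wasserstein p \<mu> \<nu> < r \<Longrightarrow> W \<nu> < c"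
proof -
  interpret Metric_space "wasserstein_space p" "wasserstein p"
    using p by (rule Metric_space_wasserstein)
  let ?T = "subtopology (wasserstein_topology p) (effective_domain p W)"
  have dom: "topspace ?T = effective_domain p W"
    by (auto simp: wasserstein_topology_def effective_domain_def)
  have "openin ?T {\<nu> \<in> topspace ?T. W \<nu> \<in> {..<c}}"
    using cont unfolding continuous_over_domain_def
    by (rule openin_continuous_map_preimage) simp
  then obtain U where U: "openin mtopology U" "{\<nu> \<in> effective_domain p W. W \<nu> < c} = U \<inter> effective_domain p W"
    unfolding dom by (auto simp: openin_subtopology wasserstein_topology_def)
  have "\<mu> \<in> U" using U(2) \<mu> c by blast
  then obtain r where r: "0 < r" "mball \<mu> r \<subseteq> U"
    using U(1) by (auto simp: openin_mtopology)
  have "W \<nu> < c" if "\<nu> \<in> effective_domain p W" "wasserstein p \<mu> \<nu> < r" for \<nu>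
  proof -
    have "\<nu> \<in> mball \<mu> r" using that \<mu> by (auto simp: effective_domain_def)
    then show ?thesis using r U(2) that by blast
  qed
  then show thesis using that r by blast
qed

text \<open>
  Measures in the domain that approximate \<open>push \<mu> \<xi> h\<close> converge to \<open>\<mu>\<close> as \<open>h\<close> tends to zero, so
  continuity keeps \<open>W\<close> below a constant \<open>c < \<alpha>\<close>, while the line \<open>\<alpha> + h * (\<rho> + e)\<close> stays above \<open>c\<close>
  whatever its slope. The slack \<open>\<alpha> - W \<mu>\<close> thus absorbs every \<open>\<rho>\<close>.
\<close>
lemma contingent_imp_slope_attainable:
  assumes p: "1 \<le> p" and cont: "continuous_over_domain p W"
    and \<mu>: "\<mu> \<in> effective_domain p W" and \<alpha>: "W \<mu> < ereal \<alpha>"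
    and \<xi>: "\<xi> \<in> contingent_cone p (effective_domain p W) \<mu>"
  shows "slope_attainable p W \<mu> \<alpha> \<xi> \<rho>"
  unfolding slope_attainable_def
proof (intro allI impI)
  fix e :: real assume e: "0 < e"
  have \<mu>_space: "\<mu> \<in> wasserstein_space p" using \<mu> by (simp add: effective_domain_def)
  have ne: "effective_domain p W \<noteq> {}" using \<mu> by blast
  have \<xi>_Lp: "\<xi> \<in> Lp_maps p \<mu>"
    and near: "\<exists>\<^sub>F h in at_right 0. \<exists>\<sigma>\<in>effective_domain p W. wasserstein p (push \<mu> \<xi> h) \<sigma> < e * h"
    using \<xi> e by (auto simp: contingent_cone_iff[OF ne])
  obtain c where c: "W \<mu> < ereal c" "c < \<alpha>"
    using ereal_dense2[OF \<alpha>] by auto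
  obtain r where r: "0 < r"
    and rW: "\<And>\<nu>. \<nu> \<in> effective_domain p W \<Longrightarrow> wasserstein p \<mu> \<nu> < r \<Longrightarrow> W \<nu> < ereal c"
    using continuous_over_domain_less_nearby[OF p cont \<mu> c(1)] by blast
  define N where "N = (\<integral>x. norm (\<xi> x) powr p \<partial>\<mu>) powr (1 / p)"
  have "((\<lambda>h. h * N + e * h) \<longlongrightarrow> 0 * N + e * 0) (at_right 0)"
    and "((\<lambda>h. \<alpha> + h * (\<rho> + e)) \<longlongrightarrow> \<alpha> + 0 * (\<rho> + e)) (at_right 0)"
    by (intro tendsto_intros)+
  then have "\<forall>\<^sub>F h in at_right 0. h * N + e * h < r" "\<forall>\<^sub>F h in at_right 0. c < \<alpha> + h * (\<rho> + e)"
    using r c(2) by (auto dest: order_tendstoD)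
  moreover have "\<forall>\<^sub>F h::real in at_right 0. 0 < h"
    by (rule eventually_at_right_less)
  ultimately have "\<forall>\<^sub>F h in at_right 0. 0 < h \<and> h * N + e * h < r \<and> c < \<alpha> + h * (\<rho> + e)"
    by eventually_elim simp
  from frequently_eventually_frequently[OF near this]
  show "\<exists>\<^sub>F h in at_right 0. \<exists>\<nu>\<in>effective_domain p W.
      wasserstein p (push \<mu> \<xi> h) \<nu> < e * h \<and> W \<nu> < ereal (\<alpha> + h * (\<rho> + e))"
  proof (rule frequently_elim1, elim conjE bexE)
    fix h \<nu> assume h: "0 < h" "h * N + e * h < r" "c < \<alpha> + h * (\<rho> + e)"
      and \<nu>: "\<nu> \<in> effective_domain p W" and close: "wasserstein p (push \<mu> \<xi> h) \<nu> < e * h"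
    have "wasserstein p \<mu> \<nu> \<le> wasserstein p \<mu> (push \<mu> \<xi> h) + wasserstein p (push \<mu> \<xi> h) \<nu>"
      using \<nu> by (intro wasserstein_triangle p \<mu>_space push_in_wasserstein_space \<xi>_Lp)
        (simp add: effective_domain_def)
    also have "\<dots> < h * N + e * h"
      using wasserstein_push_le[OF p \<mu>_space \<xi>_Lp, of h] h close by (simp add: N_def)
    finally have "W \<nu> < ereal c"
      using h by (intro rW \<nu>) simp
    also have "\<dots> < ereal (\<alpha> + h * (\<rho> + e))"
      using h by simp
    finally show "\<exists>\<nu>\<in>effective_domain p W.
        wasserstein p (push \<mu> \<xi> h) \<nu> < e * h \<and> W \<nu> < ereal (\<alpha> + h * (\<rho> + e))"
      using close \<nu> by blast
  qed
qed

theorem proposition5p5: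
  fixes p :: real and W :: "(real ^ 'd) measure \<Rightarrow> ereal"
  assumes "1 < p"
    and "\<And>\<mu>. \<mu> \<in> wasserstein_space p \<Longrightarrow> W \<mu> \<noteq> -\<infinity>"
    and "compact_sublevels p W"
    and "continuous_over_domain p W"
  shows "\<forall>M \<mu> \<alpha> \<xi> \<rho>.
    M \<in> epigraph_set p W \<and> \<mu> \<in> wasserstein_space p \<and> M = \<mu> \<Otimes>\<^sub>M return borel \<alpha> \<and>
    \<xi> \<in> Lp_maps p \<mu> \<longrightarrow>
    ((\<lambda>(x, a). (\<xi> x, \<rho>)) \<in> contingent_cone p (epigraph_set p W) M \<longleftrightarrow>
      (ereal \<alpha> = W \<mu> \<longrightarrow>
         \<xi> \<in> contingent_cone p (effective_domain p W) \<mu> \<and>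
         lower_dir_deriv p W \<mu> \<xi> \<le> ereal \<rho>) \<and>
      (ereal \<alpha> > W \<mu> \<longrightarrow>
         \<xi> \<in> contingent_cone p (effective_domain p W) \<mu>))"
proof (intro allI impI, elim conjE)
  fix M \<mu> \<alpha> \<rho> and \<xi> :: "real ^ 'd \<Rightarrow> real ^ 'd"
  assume M: "M \<in> epigraph_set p W" "M = \<mu> \<Otimes>\<^sub>M return borel \<alpha>"
    and \<mu>: "\<mu> \<in> wasserstein_space p" and \<xi>: "\<xi> \<in> Lp_maps p \<mu>"
  have p: "1 \<le> p" using assms(1) by simp
  have M_eq: "M = at_height \<mu> \<alpha>"
    unfolding M(2) using wasserstein_spaceD(1,2)[OF \<mu>] by (rule pair_return_eq_at_height)
  then obtain \<nu> b where "at_height \<mu> \<alpha> = at_height \<nu> b" "\<nu> \<in> wasserstein_space p" "W \<nu> \<le> ereal b"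
    using M(1) unfolding epigraph_set_eq[OF p] by blast
  then have le: "W \<mu> \<le> ereal \<alpha>"
    using at_height_inject[OF p \<mu>] by metis
  then have dom: "\<mu> \<in> effective_domain p W"
    using \<mu> by (auto simp: effective_domain_def)
  have cone: "(\<lambda>(x, a). (\<xi> x, \<rho>)) \<in> contingent_cone p (epigraph_set p W) M \<longleftrightarrow>
      slope_attainable p W \<mu> \<alpha> \<xi> \<rho>"
    unfolding M_eq using p \<mu> \<xi> le by (rule contingent_cone_epigraph_iff)
  show "(\<lambda>(x, a). (\<xi> x, \<rho>)) \<in> contingent_cone p (epigraph_set p W) M \<longleftrightarrow>
      (ereal \<alpha> = W \<mu> \<longrightarrow>
         \<xi> \<in> contingent_cone p (effective_domain p W) \<mu> \<and>
         lower_dir_deriv p W \<mu> \<xi> \<le> ereal \<rho>) \<and>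
      (ereal \<alpha> > W \<mu> \<longrightarrow>
         \<xi> \<in> contingent_cone p (effective_domain p W) \<mu>)"
  proof (cases "W \<mu> = ereal \<alpha>")
    case True
    then show ?thesis
      using cone lower_dir_deriv_le_iff[where W=W and \<mu>=\<mu> and \<xi>=\<xi> and \<rho>=\<rho>, OF assms(2) True]
        slope_attainable_imp_contingent[OF dom \<xi>] by auto
  next
    case False
    then have less: "W \<mu> < ereal \<alpha>" using le by simp
    then show ?thesis
      using cone contingent_imp_slope_attainable[OF p assms(4) dom less]
        slope_attainable_imp_contingent[OF dom \<xi>] by auto
  qed
qed

end
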